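(* On the $3$-dimensional nearest-neighbour qubit lattice $\{0,\dots,L-1\}^3$ ($N=L^3$), for any two dimensional hierarchies $\sigma,\sigma'$ of the three dimensions there is a circuit of $\mathcal O(N)$ nearest-neighbour CNOT/CZ gates and single-qubit Clifford gates, of depth $\mathcal O(L)=\mathcal O(N^{1/3})$, that maps the JW encoding with ordering $m_S^{\sigma}$ to the JW encoding with ordering $m_S^{\sigma'}$.
   Context: Qubits are indexed by $v=(v_1,\dots,v_d)\in\{0,\dots,L-1\}^d$ (here $d=3$), two-qubit gates only between sites at $\ell_1$-distance 1; mode $j$ is identified with qubit $j$. For $s,t\in\{0,\dots,L-1\}$-valued integers, $\rho_s(t)=t$ if $s$ is even and $\rho_s(t)=L-1-t$ if $s$ is odd. A dimensional hierarchy is a permutation $\sigma=(\sigma_1,\dots,\sigma_d)$ of $\{1,\dots,d\}$ ($\sigma_1$ lowest, $\sigma_d$ highest). The $d$-dimensional snake (S-pattern) ordering is $m_S^\sigma(v)=\sum_{i=1}^{d}L^{i-1}\rho_{s_i}(v_{\sigma_i})$ with $s_i=\sum_{k=i+1}^{d}v_{\sigma_k}$ (empty sum $=0$). The JW encoding with ordering $m$ has Majoranas $\chi^{(m)}_{2j}=X_j\prod_{k:m(k)<m(j)}Z_k$, $\chi^{(m)}_{2j+1}=Y_j\prod_{k:m(k)<m(j)}Z_k$; a unitary $W$ maps the encoding with ordering $m$ to that with $m'$ if $W\chi^{(m)}_aW^\dagger=\chi^{(m')}_a$ for all $a$. *)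

theory Defs
  imports Complex_Main "HOL-Library.FuncSet" "HOL-Combinatorics.Permutations"
begin

text \<open>Sites of the 3D lattice: v = (v 1, v 2, v 3) with v i < L (extensional functions on {1,2,3}).\<close>
type_synonym site = "nat \<Rightarrow> nat"
type_synonym bstate = "site \<Rightarrow> bool"
type_synonym qop = "bstate \<Rightarrow> bstate \<Rightarrow> complex"
type_synonym mat1 = "bool \<Rightarrow> bool \<Rightarrow> complex"

definition sites :: "nat \<Rightarrow> site set" where
  "sites L = PiE {1,2,3} (\<lambda>_. {..<L})"

definition basis :: "nat \<Rightarrow> bstate set" where
  "basis L = PiE (sites L) (\<lambda>_. UNIV)"

definition adjacent :: "site \<Rightarrow> site \<Rightarrow> bool" where
  "adjacent v w \<longleftrightarrow> (\<Sum>i\<in>{1,2,3::nat}. nat \<bar>int (v i) - int (w i)\<bar>) = 1"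

definition op_mul :: "nat \<Rightarrow> qop \<Rightarrow> qop \<Rightarrow> qop" where
  "op_mul L A B = (\<lambda>x y. \<Sum>z\<in>basis L. A x z * B z y)"

definition op_adj :: "qop \<Rightarrow> qop" where
  "op_adj A = (\<lambda>x y. cnj (A y x))"

definition op_id :: qop where
  "op_id = (\<lambda>x y. if x = y then 1 else 0)"

definition op_eq :: "nat \<Rightarrow> qop \<Rightarrow> qop \<Rightarrow> bool" where
  "op_eq L A B \<longleftrightarrow> (\<forall>x\<in>basis L. \<forall>y\<in>basis L. A x y = B x y)"

definition on1 :: "nat \<Rightarrow> site \<Rightarrow> mat1 \<Rightarrow> qop" where
  "on1 L j M = (\<lambda>x y. if (\<forall>k\<in>sites L - {j}. x k = y k) then M (x j) (y j) else 0)"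

text \<open>A 4x4 matrix acting on qubits j, k: M a b a' b' = <a b| M |a' b'>.\<close>
definition on2 :: "nat \<Rightarrow> site \<Rightarrow> site \<Rightarrow> (bool \<Rightarrow> bool \<Rightarrow> bool \<Rightarrow> bool \<Rightarrow> complex) \<Rightarrow> qop" where
  "on2 L j k M = (\<lambda>x y. if (\<forall>l\<in>sites L - {j,k}. x l = y l)
                         then M (x j) (x k) (y j) (y k) else 0)"

text \<open>Pauli matrices, with False = |0>, True = |1>.\<close>
definition pauliX :: mat1 where "pauliX = (\<lambda>a b. if a \<noteq> b then 1 else 0)"
definition pauliY :: mat1 where
  "pauliY = (\<lambda>a b. if a = b then 0 else (if a then \<i> else - \<i>))"
definition pauliZ :: mat1 where
  "pauliZ = (\<lambda>a b. if a = b then (if a then -1 else 1) else 0)"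

definition cnot_mat :: "bool \<Rightarrow> bool \<Rightarrow> bool \<Rightarrow> bool \<Rightarrow> complex" where
  "cnot_mat = (\<lambda>a b a' b'. if a = a' \<and> b = (b' \<noteq> a') then 1 else 0)"
definition cz_mat :: "bool \<Rightarrow> bool \<Rightarrow> bool \<Rightarrow> bool \<Rightarrow> complex" where
  "cz_mat = (\<lambda>a b a' b'. if a = a' \<and> b = b' then (if a \<and> b then -1 else 1) else 0)"

definition mul1 :: "mat1 \<Rightarrow> mat1 \<Rightarrow> mat1" where
  "mul1 M N = (\<lambda>a b. \<Sum>c\<in>UNIV. M a c * N c b)"
definition adj1 :: "mat1 \<Rightarrow> mat1" where "adj1 M = (\<lambda>a b. cnj (M b a))"
definition id1 :: mat1 where "id1 = (\<lambda>a b. if a = b then 1 else 0)"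

definition unitary1 :: "mat1 \<Rightarrow> bool" where
  "unitary1 U \<longleftrightarrow> mul1 U (adj1 U) = id1 \<and> mul1 (adj1 U) U = id1"

definition clifford1 :: "mat1 \<Rightarrow> bool" where
  "clifford1 U \<longleftrightarrow> unitary1 U \<and>
     (\<forall>P\<in>{pauliX, pauliY, pauliZ}. \<exists>Q\<in>{pauliX, pauliY, pauliZ}. \<exists>s\<in>{1, -1::complex}.
        mul1 (mul1 U P) (adj1 U) = (\<lambda>a b. s * Q a b))"

datatype gate = CNOT site site | CZ site site | Cliff1 site mat1

fun gate_qubits :: "gate \<Rightarrow> site set" where
  "gate_qubits (CNOT c t) = {c, t}"
| "gate_qubits (CZ a b) = {a, b}"
| "gate_qubits (Cliff1 j U) = {j}"

fun gate_ok :: "nat \<Rightarrow> gate \<Rightarrow> bool" where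
  "gate_ok L (CNOT c t) \<longleftrightarrow> c \<in> sites L \<and> t \<in> sites L \<and> adjacent c t"
| "gate_ok L (CZ a b) \<longleftrightarrow> a \<in> sites L \<and> b \<in> sites L \<and> adjacent a b"
| "gate_ok L (Cliff1 j U) \<longleftrightarrow> j \<in> sites L \<and> clifford1 U"

fun gate_op :: "nat \<Rightarrow> gate \<Rightarrow> qop" where
  "gate_op L (CNOT c t) = on2 L c t cnot_mat"
| "gate_op L (CZ a b) = on2 L a b cz_mat"
| "gate_op L (Cliff1 j U) = on1 L j U"

text \<open>A circuit is a list of layers (time steps); each layer consists of gates on disjoint qubits.\<close>
type_synonym circuit = "gate list list"

definition layer_ok :: "nat \<Rightarrow> gate list \<Rightarrow> bool" where
  "layer_ok L ly \<longleftrightarrow> (\<forall>g\<in>set ly. gate_ok L g) \<and>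
     (\<forall>i<length ly. \<forall>k<length ly. i \<noteq> k \<longrightarrow> gate_qubits (ly ! i) \<inter> gate_qubits (ly ! k) = {})"

definition circuit_ok :: "nat \<Rightarrow> circuit \<Rightarrow> bool" where
  "circuit_ok L C \<longleftrightarrow> (\<forall>ly\<in>set C. layer_ok L ly)"

definition depth :: "circuit \<Rightarrow> nat" where "depth C = length C"
definition gate_count :: "circuit \<Rightarrow> nat" where "gate_count C = sum_list (map length C)"

definition circuit_op :: "nat \<Rightarrow> circuit \<Rightarrow> qop" where
  "circuit_op L C = foldl (\<lambda>W g. op_mul L (gate_op L g) W) op_id (concat C)"

text \<open>Product of Z_k over all sites k with m k < m j (diagonal operator).\<close>
definition zbefore :: "nat \<Rightarrow> (site \<Rightarrow> nat) \<Rightarrow> site \<Rightarrow> qop" where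
  "zbefore L m j = (\<lambda>x y. if x = y then (-1) ^ card {k\<in>sites L. m k < m j \<and> x k} else 0)"

text \<open>Majorana operators: b = False gives chi_{2j} = X_j prod Z_k, b = True gives chi_{2j+1} = Y_j prod Z_k.\<close>
definition majorana :: "nat \<Rightarrow> (site \<Rightarrow> nat) \<Rightarrow> site \<Rightarrow> bool \<Rightarrow> qop" where
  "majorana L m j b = op_mul L (on1 L j (if b then pauliY else pauliX)) (zbefore L m j)"

definition maps_encoding :: "nat \<Rightarrow> (site \<Rightarrow> nat) \<Rightarrow> (site \<Rightarrow> nat) \<Rightarrow> qop \<Rightarrow> bool" where
  "maps_encoding L m m' W \<longleftrightarrow> (\<forall>j\<in>sites L. \<forall>b.
     op_eq L (op_mul L (op_mul L W (majorana L m j b)) (op_adj W)) (majorana L m' j b))"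

definition rho :: "nat \<Rightarrow> nat \<Rightarrow> nat \<Rightarrow> nat" where
  "rho L s t = (if even s then t else L - 1 - t)"

definition snake :: "nat \<Rightarrow> (nat \<Rightarrow> nat) \<Rightarrow> site \<Rightarrow> nat" where
  "snake L \<sigma> v = (\<Sum>i\<in>{1..3}. L ^ (i - 1) * rho L (\<Sum>k\<in>{i+1..3}. v (\<sigma> k)) (v (\<sigma> i)))"

end

theory Submission
  imports Defs "HOL-Library.Z2"
begin

text \<open>
  The encoding change is diagonal: it is the product of the CZ gates over all pairs of sites whose
  order differs, that is \<open>(-1)\<^sup>q\<close> for a quadratic form \<open>q\<close> over the field with two elements.
  Swapping the two lowest dimensions gives, in each plane, a form that pairs each site with the
  opposite quadrant, plus pairings within alternate rows and columns. CNOT chains of depth \<open>L\<close> replace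
  the bits by prefix sums along rows and columns, after which \<open>q\<close> couples only sites of a common
  plaquette; the chains are then undone. Swapping the two highest dimensions preserves every line
  along the lowest one together with its direction, so there \<open>q\<close> is the same planar form in the
  line parities. At most three such swaps connect any two hierarchies.
\<close>

text \<open>By default the simplifier turns \<open>+\<close> and \<open>*\<close> on \<open>bit\<close> into bit operations, which blocks ring
  normalization.\<close>

declare add_bit_eq_xor [simp del] mult_bit_eq_and [simp del]

lemma bit_add_self [simp]: "(a::bit) + a = 0"
  by (cases a) simp_all

lemma bit_add_self_left [simp]: "(a::bit) + (a + b) = b"
  by (simp flip: add.assoc)

type_synonym bvec = "site \<Rightarrow> bit"

section \<open>Diagonal circuits\<close>

definition two_qubit :: "gate \<Rightarrow> bool" where
  "two_qubit g \<longleftrightarrow> (\<forall>j U. g \<noteq> Cliff1 j U)"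

text \<open>The values on \<open>Cliff1\<close> below are junk: single-qubit gates are never needed.\<close>

fun gate_map :: "gate \<Rightarrow> bvec \<Rightarrow> bvec" where
  "gate_map (CNOT c t) z = z(t := z t + z c)"
| "gate_map (CZ a b) z = z"
| "gate_map (Cliff1 j U) z = z"

fun gate_phase :: "gate \<Rightarrow> bvec \<Rightarrow> bit" where
  "gate_phase (CNOT c t) z = 0"
| "gate_phase (CZ a b) z = z a * z b"
| "gate_phase (Cliff1 j U) z = 0"

fun run_map :: "gate list \<Rightarrow> bvec \<Rightarrow> bvec" where
  "run_map [] z = z"
| "run_map (g # gs) z = run_map gs (gate_map g z)"

fun run_phase :: "gate list \<Rightarrow> bvec \<Rightarrow> bit" where
  "run_phase [] z = 0"
| "run_phase (g # gs) z = gate_phase g z + run_phase gs (gate_map g z)"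

lemma run_map_append [simp]: "run_map (gs @ hs) z = run_map hs (run_map gs z)"
  by (induction gs arbitrary: z) simp_all

lemma run_phase_append [simp]:
  "run_phase (gs @ hs) z = run_phase gs z + run_phase hs (run_map gs z)"
  by (induction gs arbitrary: z) (simp_all add: add.assoc)

section \<open>Circuits as signed permutations of basis states\<close>

definition bvec_of :: "bstate \<Rightarrow> bvec" where "bvec_of y = (\<lambda>v. of_bool (y v))"

definition sign :: "bit \<Rightarrow> complex" where "sign b = (if b = 0 then 1 else - 1)"

lemma sign_0 [simp]: "sign 0 = 1" and sign_1 [simp]: "sign 1 = - 1"
  by (simp_all add: sign_def)

lemma sign_add: "sign (a + b) = sign a * sign b"
  by (cases a; cases b) (simp_all add: sign_def)

lemma cnj_sign [simp]: "cnj (sign b) = sign b"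
  by (simp add: sign_def)

lemma sign_sum_bvec_of:
  assumes "finite A"
  shows "sign (\<Sum>k\<in>A. bvec_of y k) = (- 1) ^ card {k \<in> A. y k}"
  using assms
proof (induction A rule: finite_induct)
  case (insert a A)
  have "{k \<in> insert a A. y k} = (if y a then insert a {k \<in> A. y k} else {k \<in> A. y k})"
    by auto
  with insert show ?case
    by (auto simp: sign_add bvec_of_def)
qed simp

text \<open>Operators are indexed by \<open>bstate\<close>, while the algebra is done over
  \<open>bit\<close>; \<open>bvec_of\<close> intertwines this action with
  \<open>gate_map\<close>.\<close>

fun gate_act :: "gate \<Rightarrow> bstate \<Rightarrow> bstate" where
  "gate_act (CNOT c t) y = y(t := (y t \<noteq> y c))"
| "gate_act (CZ a b) y = y"
| "gate_act (Cliff1 j U) y = y"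

lemma bvec_of_gate_act: "bvec_of (gate_act g y) = gate_map g (bvec_of y)"
  by (cases g) (auto simp: bvec_of_def fun_eq_iff)

lemma bvec_of_fold_gate_act:
  "bvec_of (fold gate_act gs y) = run_map gs (bvec_of y)"
  by (induction gs arbitrary: y) (simp_all add: bvec_of_gate_act)

lemma bvec_of_inj: "bvec_of x = bvec_of y \<longleftrightarrow> x = y"
proof
  assume eq: "bvec_of x = bvec_of y"
  show "x = y"
  proof
    fix v
    show "x v = y v" using fun_cong[OF eq, of v] by (cases "x v"; cases "y v") (simp_all add: bvec_of_def)
  qed
qed simp

lemma finite_sites [simp]: "finite (sites L)"
  by (simp add: sites_def finite_PiE)

lemma card_sites: "card (sites L) = L ^ 3"
  by (simp add: sites_def card_PiE power3_eq_cube)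

lemma finite_basis [simp]: "finite (basis L)"
  unfolding basis_def by (intro finite_PiE) simp_all

lemma basis_eqI:
  "x \<in> basis L \<Longrightarrow> y \<in> basis L \<Longrightarrow> (\<And>v. v \<in> sites L \<Longrightarrow> x v = y v) \<Longrightarrow> x = y"
  unfolding basis_def by (rule PiE_ext)

lemma basis_upd: "y \<in> basis L \<Longrightarrow> v \<in> sites L \<Longrightarrow> y(v := b) \<in> basis L"
  by (auto simp: basis_def PiE_def extensional_def)

lemma adjacent_neq: "adjacent v w \<Longrightarrow> v \<noteq> w"
  by (auto simp: adjacent_def)

lemma gate_act_basis: "gate_ok L g \<Longrightarrow> y \<in> basis L \<Longrightarrow> gate_act g y \<in> basis L"
  by (cases g) (auto intro: basis_upd)

lemma fold_gate_act_basis: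
  "(\<And>g. g \<in> set gs \<Longrightarrow> gate_ok L g) \<Longrightarrow> y \<in> basis L \<Longrightarrow> fold gate_act gs y \<in> basis L"
  by (induction gs arbitrary: y) (simp_all add: gate_act_basis)

text \<open>A CNOT or CZ matrix has one nonzero entry per column, a sign. Basis states are
  extensional, so agreement on \<open>sites L\<close> already forces equality.\<close>

lemma gate_op_monomial:
  assumes "gate_ok L g" "two_qubit g" "x \<in> basis L" "y \<in> basis L"
  shows "gate_op L g x y
    = (if x = gate_act g y then sign (gate_phase g (bvec_of y)) else 0)"
proof (cases g)
  case (CNOT c t)
  then have ct: "c \<in> sites L" "t \<in> sites L" "c \<noteq> t"
    using assms(1) adjacent_neq by auto
  have "x = gate_act g y \<longleftrightarrow>
      (\<forall>l\<in>sites L - {c, t}. x l = y l) \<and> x c = y c \<and> x t = (y t \<noteq> y c)"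
  proof
    assume "(\<forall>l\<in>sites L - {c, t}. x l = y l) \<and> x c = y c \<and> x t = (y t \<noteq> y c)"
    then show "x = gate_act g y"
      by (intro basis_eqI[OF assms(3) gate_act_basis[OF assms(1,4)]]) (auto simp: CNOT)
  qed (use ct CNOT in auto)
  then show ?thesis
    by (auto simp: CNOT on2_def cnot_mat_def)
next
  case (CZ a b)
  then have ab: "a \<in> sites L" "b \<in> sites L"
    using assms(1) by auto
  have "x = y \<longleftrightarrow> (\<forall>l\<in>sites L - {a, b}. x l = y l) \<and> x a = y a \<and> x b = y b"
  proof
    assume *: "(\<forall>l\<in>sites L - {a, b}. x l = y l) \<and> x a = y a \<and> x b = y b"
    show "x = y"
    proof (rule basis_eqI[OF assms(3,4)])
      fix v
      assume "v \<in> sites L"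
      with * show "x v = y v" by (cases "v = a"; cases "v = b") simp_all
    qed
  qed simp
  then show ?thesis
    by (auto simp: CZ on2_def cz_mat_def bvec_of_def)
qed (use assms(2) in \<open>simp add: two_qubit_def\<close>)

text \<open>The sum over intermediate states collapses to \<open>h y\<close>, the only row in which
  column \<open>y\<close> of \<open>B\<close> is nonzero.\<close>

lemma op_mul_monomial:
  assumes "x \<in> basis L" "y \<in> basis L" "h y \<in> basis L"
    and "\<And>z. z \<in> basis L \<Longrightarrow> B z y = (if z = h y then s else 0)"
  shows "op_mul L A B x y = A x (h y) * s"
proof -
  have "op_mul L A B x y = (\<Sum>z\<in>basis L. if z = h y then A x (h y) * s else 0)"
    unfolding op_mul_def by (intro sum.cong) (auto simp: assms(4))
  with assms(3) show ?thesis
    by (simp add: sum.delta)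
qed

text \<open>Induction at the right end, since a later gate multiplies from the left; its sign is
  read off the state reached so far.\<close>

lemma fold_gate_op:
  assumes "\<And>g. g \<in> set gs \<Longrightarrow> gate_ok L g \<and> two_qubit g" "x \<in> basis L" "y \<in> basis L"
  shows "foldl (\<lambda>W g. op_mul L (gate_op L g) W) op_id gs x y
    = (if x = fold gate_act gs y then sign (run_phase gs (bvec_of y)) else 0)"
  using assms
proof (induction gs arbitrary: x rule: rev_induct)
  case (snoc g gs)
  let ?y = "fold gate_act gs y"
  have yb: "?y \<in> basis L"
    using snoc.prems by (intro fold_gate_act_basis) auto
  have "foldl (\<lambda>W g. op_mul L (gate_op L g) W) op_id (gs @ [g]) x y
      = gate_op L g x ?y * sign (run_phase gs (bvec_of y))"
    using snoc by (simp, intro op_mul_monomial[where h = "fold gate_act gs"] yb) auto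
  also have "\<dots> = (if x = gate_act g ?y
      then sign (gate_phase g (bvec_of ?y)) * sign (run_phase gs (bvec_of y)) else 0)"
    using snoc.prems yb by (subst gate_op_monomial) auto
  finally show ?case
    by (simp add: bvec_of_fold_gate_act sign_add mult.commute)
qed (simp add: op_id_def)

section \<open>Quadratic forms over two elements and conjugation of Majoranas\<close>

definition quad_form :: "nat \<Rightarrow> (site \<Rightarrow> site \<Rightarrow> bit) \<Rightarrow> bvec \<Rightarrow> bit" where
  "quad_form L E z = (\<Sum>v\<in>sites L. \<Sum>w\<in>sites L. E v w * z v * z w)"

lemma quad_form_add:
  "quad_form L (\<lambda>v w. E v w + F v w) z = quad_form L E z + quad_form L F z"
  by (simp add: quad_form_def sum.distrib distrib_right)

text \<open>The right-hand side is 1 exactly when the orderings disagree on whether \<open>w\<close>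
  precedes \<open>v\<close>. Only the symmetrization of \<open>E\<close> is prescribed, so each
  unordered pair may be listed in one direction. A zero diagonal excludes linear terms, as
  \<open>z v * z v = z v\<close>.\<close>

definition inversion_form :: "nat \<Rightarrow> (site \<Rightarrow> nat) \<Rightarrow> (site \<Rightarrow> nat) \<Rightarrow> (site \<Rightarrow> site \<Rightarrow> bit) \<Rightarrow> bool" where
  "inversion_form L m m' E \<longleftrightarrow> (\<forall>v\<in>sites L. E v v = 0) \<and>
     (\<forall>v\<in>sites L. \<forall>w\<in>sites L. E v w + E w v = of_bool (m w < m v) + of_bool (m' w < m' v))"

text \<open>Discrete derivative: with \<open>d\<close> the indicator of \<open>j\<close>, expanding
  the form at \<open>z + d\<close> leaves two linear cross terms and the term \<open>E j j\<close>,
  which vanishes.\<close>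

lemma quad_form_flip:
  assumes "j \<in> sites L" "E j j = 0" "\<And>v. v \<noteq> j \<Longrightarrow> v \<in> sites L \<Longrightarrow> z' v = z v" "z' j = z j + 1"
  shows "quad_form L E z' = quad_form L E z + (\<Sum>w\<in>sites L. (E j w + E w j) * z w)"
proof -
  define d where "d = (\<lambda>v. of_bool (v = j) :: bit)"
  have z': "z' v = z v + d v" if "v \<in> sites L" for v
    using assms(3,4) that by (auto simp: d_def)
  have dj: "(\<Sum>v\<in>sites L. d v * f v) = f j" for f :: "site \<Rightarrow> bit"
  proof -
    have "(\<Sum>v\<in>sites L. d v * f v) = (\<Sum>v\<in>sites L. if v = j then f j else 0)"
      by (intro sum.cong) (auto simp: d_def)
    with assms(1) show ?thesis by simp
  qed
  have "quad_form L E z' = (\<Sum>v\<in>sites L. \<Sum>w\<in>sites L. E v w * z v * z w + d v * (E v w * z w)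
      + d w * (E v w * z v) + d v * (d w * E v w))"
    unfolding quad_form_def by (intro sum.cong refl) (simp add: z' algebra_simps)
  also have "\<dots> = quad_form L E z + (\<Sum>w\<in>sites L. E j w * z w) + (\<Sum>v\<in>sites L. E v j * z v) + E j j"
    by (simp add: sum.distrib quad_form_def dj flip: sum_distrib_left)
  finally show ?thesis
    using assms(2) by (simp add: sum.distrib algebra_simps)
qed

text \<open>A diagonal operator with signs \<open>(-1)\<^sup>q\<close> conjugates \<open>X\<^sub>j\<close> to \<open>X\<^sub>j\<close> times
  a \<open>Z\<close> string on the support of the derivative of \<open>q\<close> in direction \<open>j\<close>; that support is
  the set of sites whose order relative to \<open>j\<close> is reversed.\<close>
lemma maps_encoding_if_diagonal:
  assumes inv: "inversion_form L m m' E"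
    and W: "\<And>x y. x \<in> basis L \<Longrightarrow> y \<in> basis L \<Longrightarrow>
      W x y = (if x = y then sign (quad_form L E (bvec_of y)) else 0)"
  shows "maps_encoding L m m' W"
  unfolding maps_encoding_def op_eq_def
proof (intro ballI allI)
  fix j b x y
  assume j: "j \<in> sites L" and x: "x \<in> basis L" and y: "y \<in> basis L"
  define s where "s = (\<lambda>y. sign (quad_form L E (bvec_of y)))"
  let ?P = "if b then pauliY else pauliX"
  have maj: "majorana L n j b x y = on1 L j ?P x y * (-1) ^ card {k \<in> sites L. n k < n j \<and> y k}"
    if "x \<in> basis L" "y \<in> basis L" for n x y
    unfolding majorana_def
    by (rule op_mul_monomial[where h = id, simplified, OF that that(2)]) (simp add: zbefore_def)
  have WM: "op_mul L W (majorana L m j b) x z = s x * majorana L m j b x z" if "z \<in> basis L" for z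
  proof -
    have "op_mul L W (majorana L m j b) x z
        = (\<Sum>u\<in>basis L. if u = x then s x * majorana L m j b x z else 0)"
      unfolding op_mul_def s_def by (intro sum.cong) (auto simp: W x)
    with x show ?thesis by simp
  qed
  have "op_mul L (op_mul L W (majorana L m j b)) (op_adj W) x y
      = op_mul L W (majorana L m j b) x y * s y"
    by (rule op_mul_monomial[where h = id, simplified, OF x y y])
      (auto simp: op_adj_def W y s_def)
  also have "\<dots> = s x * majorana L m j b x y * s y"
    by (simp add: WM y)
  also have "\<dots> = majorana L m' j b x y"
  \<comment> \<open>\<open>X\<close> and \<open>Y\<close> have entries only between states that
    differ exactly at \<open>j\<close>; for those the Pauli entry is common to both sides and only
    signs remain to be compared.\<close>
  proof (cases "(\<forall>k\<in>sites L - {j}. x k = y k) \<and> x j \<noteq> y j")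
    case False
    then show ?thesis
      by (auto simp: maj x y on1_def pauliX_def pauliY_def)
  next
    case True
    let ?z = "bvec_of y"
    have zs: "(-1) ^ card {k \<in> sites L. n k < n j \<and> y k}
        = sign (\<Sum>k\<in>sites L. of_bool (n k < n j) * ?z k)" for n :: "site \<Rightarrow> nat"
    proof -
      have "(\<Sum>k\<in>sites L. of_bool (n k < n j) * ?z k) = (\<Sum>k\<in>{k \<in> sites L. n k < n j}. ?z k)"
        by (rule sum.mono_neutral_cong_right) auto
      moreover have "{k \<in> {k \<in> sites L. n k < n j}. y k} = {k \<in> sites L. n k < n j \<and> y k}"
        by auto
      ultimately show ?thesis
        by (simp add: sign_sum_bvec_of)
    qed
    have "quad_form L E (bvec_of x) = quad_form L E ?z + (\<Sum>w\<in>sites L. (E j w + E w j) * ?z w)"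
      using True j inv
      by (intro quad_form_flip) (auto simp: inversion_form_def bvec_of_def)
    also have "(\<Sum>w\<in>sites L. (E j w + E w j) * ?z w)
        = (\<Sum>w\<in>sites L. of_bool (m w < m j) * ?z w) + (\<Sum>w\<in>sites L. of_bool (m' w < m' j) * ?z w)"
      using inv j by (subst sum.distrib[symmetric], intro sum.cong)
        (auto simp: inversion_form_def distrib_right)
    finally have "s x * (-1) ^ card {k \<in> sites L. m k < m j \<and> y k} * s y
        = (-1) ^ card {k \<in> sites L. m' k < m' j \<and> y k}"
      unfolding s_def zs by (simp add: algebra_simps flip: sign_add)
    then show ?thesis
      by (simp add: maj x y mult_ac)
  qed
  finally show "op_mul L (op_mul L W (majorana L m j b)) (op_adj W) x y = majorana L m' j b x y" .
qed

section \<open>Realizable state maps and phases\<close>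

text \<open>The pair \<open>f\<close>, \<open>\<phi>\<close> encodes the monomial operator sending
  basis state \<open>z\<close> to \<open>f z\<close> with sign exponent \<open>\<phi> z\<close>;
  \<open>d\<close> and \<open>n\<close> bound depth and gate count.\<close>

definition realizable :: "nat \<Rightarrow> nat \<Rightarrow> nat \<Rightarrow> (bvec \<Rightarrow> bvec) \<Rightarrow> (bvec \<Rightarrow> bit) \<Rightarrow> bool" where
  "realizable L d n f \<phi> \<longleftrightarrow> (\<exists>C. circuit_ok L C \<and> (\<forall>g\<in>set (concat C). two_qubit g) \<and>
     depth C \<le> d \<and> gate_count C \<le> n \<and>
     (\<forall>z. run_map (concat C) z = f z \<and> run_phase (concat C) z = \<phi> z))"

lemma realizable_mono:
  "realizable L d n f \<phi> \<Longrightarrow> d \<le> d' \<Longrightarrow> n \<le> n' \<Longrightarrow> realizable L d' n' f \<phi>"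
  unfolding realizable_def by (meson le_trans)

lemma realizable_cong:
  "realizable L d n f \<phi> \<Longrightarrow> (\<And>z. f z = f' z) \<Longrightarrow> (\<And>z. \<phi> z = \<phi>' z) \<Longrightarrow> realizable L d n f' \<phi>'"
  unfolding realizable_def by simp

lemma realizable_id: "realizable L 0 0 (\<lambda>z. z) (\<lambda>_. 0)"
  unfolding realizable_def
  by (rule exI[of _ "[]"]) (simp add: circuit_ok_def depth_def gate_count_def)

lemma realizable_comp:
  assumes "realizable L d n f \<phi>" "realizable L d' n' g \<psi>"
  shows "realizable L (d + d') (n + n') (\<lambda>z. g (f z)) (\<lambda>z. \<phi> z + \<psi> (f z))"
proof -
  obtain C where C: "circuit_ok L C" "\<forall>g\<in>set (concat C). two_qubit g" "depth C \<le> d" "gate_count C \<le> n"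
    "\<forall>z. run_map (concat C) z = f z \<and> run_phase (concat C) z = \<phi> z"
    using assms(1) unfolding realizable_def by blast
  obtain D where D: "circuit_ok L D" "\<forall>g\<in>set (concat D). two_qubit g" "depth D \<le> d'" "gate_count D \<le> n'"
    "\<forall>z. run_map (concat D) z = g z \<and> run_phase (concat D) z = \<psi> z"
    using assms(2) unfolding realizable_def by blast
  have "circuit_ok L (C @ D)" "\<forall>g\<in>set (concat (C @ D)). two_qubit g"
    using C(1,2) D(1,2) unfolding circuit_ok_def by auto
  moreover have "depth (C @ D) \<le> d + d'" "gate_count (C @ D) \<le> n + n'"
    using C(3,4) D(3,4) by (simp_all add: depth_def gate_count_def)
  moreover have "run_map (concat (C @ D)) z = g (f z) \<and>
      run_phase (concat (C @ D)) z = \<phi> z + \<psi> (f z)" for z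
    using C(5) D(5) by simp
  ultimately show ?thesis
    unfolding realizable_def by blast
qed

lemma run_rev:
  assumes "\<And>g. g \<in> set gs \<Longrightarrow> gate_ok L g"
  shows "run_map (rev gs) (run_map gs z) = z \<and> run_phase (rev gs) (run_map gs z) = run_phase gs z"
  using assms
proof (induction gs arbitrary: z)
  case (Cons g gs)
  have inv: "gate_map g (gate_map g z) = z" "gate_phase g (gate_map g z) = gate_phase g z"
  proof -
    \<comment> \<open>A control distinct from its target is left unchanged, so a repeated CNOT adds
      the same bit twice.\<close>
    have "c \<noteq> t" if "g = CNOT c t" for c t
      using Cons.prems[of g] that adjacent_neq by auto
    then show "gate_map g (gate_map g z) = z" "gate_phase g (gate_map g z) = gate_phase g z"
      by (cases g; simp add: add.assoc)+
  qed
  show ?case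
    using Cons.IH[of "gate_map g z"] Cons.prems by (simp add: inv add.commute)
qed simp

lemma layer_ok_rev: "layer_ok L ly \<Longrightarrow> layer_ok L (rev ly)"
proof -
  assume ok: "layer_ok L ly"
  have "rev ly ! i = ly ! (length ly - Suc i) \<and> length ly - Suc i < length ly" if "i < length ly" for i
    using that by (auto simp: rev_nth)
  moreover have "length ly - Suc i \<noteq> length ly - Suc k"
    if "i < length ly" "k < length ly" "i \<noteq> k" for i k
    using that by auto
  ultimately show ?thesis
    using ok by (auto simp: layer_ok_def)
qed

text \<open>Every gate used here is an involution, so running the second circuit backwards undoes the
  common state map and contributes its own phase.\<close>
lemma realizable_uncompute:
  assumes "realizable L d n f \<phi>" "realizable L d' n' f \<psi>"
  shows "realizable L (d + d') (n + n') (\<lambda>z. z) (\<lambda>z. \<phi> z + \<psi> z)"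
proof -
  obtain C where C: "circuit_ok L C" "\<forall>g\<in>set (concat C). two_qubit g" "depth C \<le> d" "gate_count C \<le> n"
    "\<forall>z. run_map (concat C) z = f z \<and> run_phase (concat C) z = \<phi> z"
    using assms(1) unfolding realizable_def by blast
  obtain D where D: "circuit_ok L D" "\<forall>g\<in>set (concat D). two_qubit g" "depth D \<le> d'" "gate_count D \<le> n'"
    "\<forall>z. run_map (concat D) z = f z \<and> run_phase (concat D) z = \<psi> z"
    using assms(2) unfolding realizable_def by blast
  let ?D = "rev (map rev D)"
  have cD: "concat ?D = rev (concat D)"
    by (simp add: rev_concat rev_map)
  have "run_map (concat ?D) (f z) = z \<and> run_phase (concat ?D) (f z) = \<psi> z" for z
    using run_rev[of "concat D" L z] D(1,5)
    by (auto simp: cD circuit_ok_def layer_ok_def)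
  then have "run_map (concat (C @ ?D)) z = z \<and> run_phase (concat (C @ ?D)) z = \<phi> z + \<psi> z" for z
    using C(5) by simp
  moreover have "circuit_ok L (C @ ?D)" "\<forall>g\<in>set (concat (C @ ?D)). two_qubit g"
    using C(1,2) D(1,2) layer_ok_rev unfolding circuit_ok_def by auto
  moreover have "gate_count ?D = gate_count D"
    by (simp add: gate_count_def rev_map sum_list_rev o_def flip: rev_map)
  then have "depth (C @ ?D) \<le> d + d'" "gate_count (C @ ?D) \<le> n + n'"
    using C(3,4) D(3,4) by (simp_all add: depth_def gate_count_def)
  ultimately show ?thesis
    unfolding realizable_def by blast
qed

text \<open>Compute \<open>f\<close>, apply the diagonal phase in the new bits, uncompute
  \<open>f\<close>: its cost is paid twice.\<close>

lemma realizable_conj: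
  assumes "realizable L d n f (\<lambda>_. 0)" "realizable L d' n' (\<lambda>z. z) \<phi>"
  shows "realizable L (2 * d + d') (2 * n + n') (\<lambda>z. z) (\<lambda>z. \<phi> (f z))"
  using realizable_uncompute[OF realizable_comp[OF assms] assms(1)]
  by (simp add: mult_2 add_ac)

section \<open>Single layers of gates\<close>

lemma layer_ok_map:
  assumes "distinct vs" "\<And>v. v \<in> set vs \<Longrightarrow> gate_ok L (g v)"
    and "\<And>v w. v \<in> set vs \<Longrightarrow> w \<in> set vs \<Longrightarrow> v \<noteq> w \<Longrightarrow> gate_qubits (g v) \<inter> gate_qubits (g w) = {}"
  shows "layer_ok L (map g vs)"
  using assms by (auto simp: layer_ok_def nth_eq_iff_index_eq)

lemma realizable_layer:
  assumes "A \<subseteq> sites L" "\<And>v. v \<in> A \<Longrightarrow> gate_ok L (g v) \<and> two_qubit (g v)"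
    and "\<And>v w. v \<in> A \<Longrightarrow> w \<in> A \<Longrightarrow> v \<noteq> w \<Longrightarrow> gate_qubits (g v) \<inter> gate_qubits (g w) = {}"
    and "\<And>vs z. distinct vs \<Longrightarrow> set vs = A \<Longrightarrow> run_map (map g vs) z = f z \<and> run_phase (map g vs) z = \<phi> z"
  shows "realizable L 1 (card A) f \<phi>"
proof -
  obtain vs where vs: "set vs = A" "distinct vs"
    using finite_distinct_list finite_subset[OF assms(1) finite_sites] by blast
  show ?thesis
    unfolding realizable_def
    using layer_ok_map[of vs L g] assms vs distinct_card[OF vs(2)]
    by (intro exI[of _ "[map g vs]"]) (auto simp: circuit_ok_def depth_def gate_count_def)
qed

text \<open>Each \<open>v\<close> interacts with a partner \<open>s v\<close>. Partners are distinct
  and lie outside \<open>A\<close>, so the gates touch disjoint qubits.\<close>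

lemma realizable_CZ_layer:
  assumes "A \<subseteq> sites L" "\<And>v. v \<in> A \<Longrightarrow> s v \<in> sites L \<and> adjacent (s v) v"
    and "\<And>v. v \<in> A \<Longrightarrow> s v \<notin> A" "inj_on s A"
  shows "realizable L 1 (card A) (\<lambda>z. z) (\<lambda>z. \<Sum>v\<in>A. z (s v) * z v)"
proof (rule realizable_layer[where g = "\<lambda>v. CZ (s v) v"])
  show "run_map (map (\<lambda>v. CZ (s v) v) vs) z = z \<and>
      run_phase (map (\<lambda>v. CZ (s v) v) vs) z = (\<Sum>v\<in>A. z (s v) * z v)"
    if "distinct vs" "set vs = A" for vs z
    using that(1) unfolding that(2)[symmetric] by (induction vs) auto
qed (use assms in \<open>auto simp: two_qubit_def inj_on_eq_iff\<close>)

text \<open>No control \<open>s v\<close> is itself a target, so every control keeps its initial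
  value throughout the layer, whatever the order of the gates.\<close>

lemma realizable_CNOT_layer:
  assumes "A \<subseteq> sites L" "\<And>v. v \<in> A \<Longrightarrow> s v \<in> sites L \<and> adjacent (s v) v"
    and "\<And>v. v \<in> A \<Longrightarrow> s v \<notin> A" "inj_on s A"
  shows "realizable L 1 (card A) (\<lambda>z w. if w \<in> A then z w + z (s w) else z w) (\<lambda>_. 0)"
proof (rule realizable_layer[where g = "\<lambda>v. CNOT (s v) v"])
  fix vs z
  assume "distinct vs" "set vs = A"
  then have "distinct vs" "\<And>v. v \<in> set vs \<Longrightarrow> s v \<notin> set vs"
    using assms(3) by auto
  then have "run_map (map (\<lambda>v. CNOT (s v) v) vs) z = (\<lambda>w. if w \<in> set vs then z w + z (s w) else z w)"
  proof (induction vs arbitrary: z)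
    case (Cons v vs)
    then show ?case
      by (subst list.map, subst run_map.simps, subst Cons.IH) (auto intro!: ext)
  qed simp
  moreover have "run_phase (map (\<lambda>v. CNOT (s v) v) vs) z = 0"
    by (induction vs arbitrary: z) auto
  ultimately show "run_map (map (\<lambda>v. CNOT (s v) v) vs) z = (\<lambda>w. if w \<in> A then z w + z (s w) else z w) \<and>
      run_phase (map (\<lambda>v. CNOT (s v) v) vs) z = 0"
    using \<open>set vs = A\<close> by simp
qed (use assms in \<open>auto simp: two_qubit_def inj_on_eq_iff\<close>)

section \<open>Chains along lines and phases on plaquettes\<close>

lemma sites_upd: "v \<in> sites L \<Longrightarrow> i \<in> {1,2,3} \<Longrightarrow> a < L \<Longrightarrow> v(i := a) \<in> sites L"
  by (auto simp: sites_def PiE_def extensional_def Pi_def)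

lemma sites_less: "v \<in> sites L \<Longrightarrow> i \<in> {1,2,3} \<Longrightarrow> v i < L"
  by (auto simp: sites_def PiE_def Pi_def)

lemma adjacent_upd_Suc:
  assumes "i \<in> {1,2,3}" "b = Suc a \<or> a = Suc b"
  shows "adjacent (v(i := a)) (v(i := b))"
  using assms by (auto simp: adjacent_def)

text \<open>Off the lattice the value is kept, because \<open>realizable\<close> compares state maps
  on all functions and gates act on lattice sites only.\<close>

definition prefix :: "nat \<Rightarrow> nat \<Rightarrow> bvec \<Rightarrow> bvec" where
  "prefix L i z = (\<lambda>w. if w \<in> sites L then \<Sum>a\<le>w i. z (w(i := a)) else z w)"

text \<open>A coupling of arbitrarily distant sites of a line; \<open>H\<close> filters by the later
  site of each pair.\<close>

definition line_phase :: "nat \<Rightarrow> nat \<Rightarrow> (site \<Rightarrow> bool) \<Rightarrow> bvec \<Rightarrow> bit" where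
  "line_phase L i H z = (\<Sum>w\<in>{w \<in> sites L. H w}. z w * (\<Sum>a<w i. z (w(i := a))))"

text \<open>When the chain reaches coordinate \<open>Suc n\<close>, the preceding site holds the
  prefix sum up to \<open>n\<close>. A CZ with it emits the whole line coupling of the new site, and
  a CNOT from it then extends the prefix sum. Hence two layers per step and two gates per
  site.\<close>

lemma realizable_chain:
  assumes i: "i \<in> {1,2,3::nat}"
  shows "realizable L (2 * n) (2 * card {w \<in> sites L. w i \<noteq> 0 \<and> w i \<le> n})
    (\<lambda>z w. if w \<in> sites L \<and> w i \<le> n then \<Sum>a\<le>w i. z (w(i := a)) else z w)
    (\<lambda>z. \<Sum>w\<in>{w \<in> sites L. H w \<and> w i \<le> n}. z w * (\<Sum>a<w i. z (w(i := a))))"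
proof (induction n)
  case 0
  have eq: "(if w \<in> sites L \<and> w i \<le> 0 then \<Sum>a\<le>w i. z (w(i := a)) else z w) = z w" for z w
    by (simp add: fun_upd_idem)
  have "(\<Sum>w\<in>{w \<in> sites L. H w \<and> w i \<le> 0}. z w * (\<Sum>a<w i. z (w(i := a)))) = 0" for z :: bvec
    by (intro sum.neutral) auto
  then show ?case
    unfolding eq by (intro realizable_mono[OF realizable_cong[OF realizable_id]]) simp_all
next
  case (Suc n)
  define A where "A = {w \<in> sites L. w i = Suc n}"
  define s where "s = (\<lambda>w::site. w(i := n))"
  let ?f = "\<lambda>z w. if w \<in> sites L \<and> w i \<le> n then \<Sum>a\<le>w i. z (w(i := a)) else z w :: bit"
  have s: "s v \<in> sites L \<and> adjacent (s v) v" "s v \<notin> A" if "v \<in> A" for v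
  proof -
    have "v = v(i := Suc n)" using that by (auto simp: A_def)
    then have "adjacent (s v) v"
      using adjacent_upd_Suc[OF i, of "Suc n" n v] by (simp add: s_def)
    then show "s v \<in> sites L \<and> adjacent (s v) v" "s v \<notin> A"
      using that i sites_less[of v L i] by (auto simp: A_def s_def intro!: sites_upd)
  qed
  have inj: "inj_on s B" if "B \<subseteq> A" for B
  proof (rule inj_onI)
    fix v w assume "v \<in> B" "w \<in> B" "s v = s w"
    with that have "v i = Suc n" "w i = Suc n"
      by (auto simp: A_def)
    then have "v = (s v)(i := Suc n)" "w = (s w)(i := Suc n)"
      by (simp_all add: s_def fun_upd_idem)
    with \<open>s v = s w\<close> show "v = w" by simp
  qed
  define B where "B = {w \<in> A. H w}"
  have BA: "B \<subseteq> A" "A \<subseteq> sites L" by (auto simp: B_def A_def)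
  have "realizable L 1 (card B) (\<lambda>z. z) (\<lambda>z. \<Sum>v\<in>B. z (s v) * z v)"
    using s BA by (intro realizable_CZ_layer inj) auto
  then have cz: "realizable L 1 (card A) (\<lambda>z. z) (\<lambda>z. \<Sum>v\<in>B. z (s v) * z v)"
    by (rule realizable_mono) (use BA finite_subset[OF BA(2)] in \<open>auto intro: card_mono\<close>)
  have cnot: "realizable L 1 (card A) (\<lambda>z w. if w \<in> A then z w + z (s w) else z w) (\<lambda>_. 0)"
    using s by (intro realizable_CNOT_layer inj) (auto simp: A_def)
  have split: "{w \<in> sites L. w i \<noteq> 0 \<and> w i \<le> Suc n} = {w \<in> sites L. w i \<noteq> 0 \<and> w i \<le> n} \<union> A"
    by (auto simp: A_def)
  have card: "card {w \<in> sites L. w i \<noteq> 0 \<and> w i \<le> Suc n} = card {w \<in> sites L. w i \<noteq> 0 \<and> w i \<le> n} + card A"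
    unfolding split by (rule card_Un_disjoint) (auto simp: A_def)
  have fs: "?f z (s w) = (\<Sum>a\<le>n. z (w(i := a)))" "?f z w = z w" if "w \<in> A" for z w
    using s(1)[OF that] that by (simp_all add: A_def s_def)
  have f: "(if w \<in> A then ?f z w + ?f z (s w) else ?f z w)
      = (if w \<in> sites L \<and> w i \<le> Suc n then \<Sum>a\<le>w i. z (w(i := a)) else z w)" for z w
  proof (cases "w \<in> A")
    case True
    then have "w(i := Suc n) = w" "w \<in> sites L" "w i = Suc n" by (auto simp: A_def)
    with fs[OF True] True show ?thesis by (simp add: add.commute)
  qed (auto simp: A_def le_Suc_eq)
  have \<phi>: "(\<Sum>w\<in>{w \<in> sites L. H w \<and> w i \<le> n}. z w * (\<Sum>a<w i. z (w(i := a))))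
        + (\<Sum>v\<in>B. ?f z (s v) * ?f z v)
      = (\<Sum>w\<in>{w \<in> sites L. H w \<and> w i \<le> Suc n}. z w * (\<Sum>a<w i. z (w(i := a))))" for z
  proof -
    have "(\<Sum>v\<in>B. ?f z (s v) * ?f z v) = (\<Sum>w\<in>B. z w * (\<Sum>a<w i. z (w(i := a))))"
    proof (intro sum.cong refl)
      fix v assume "v \<in> B"
      then have "v \<in> A" by (simp add: B_def)
      then have "v i = Suc n" by (simp add: A_def)
      then show "?f z (s v) * ?f z v = z v * (\<Sum>a<v i. z (v(i := a)))"
        unfolding fs[OF \<open>v \<in> A\<close>] by (simp add: lessThan_Suc_atMost mult.commute)
    qed
    moreover have "{w \<in> sites L. H w \<and> w i \<le> Suc n} = {w \<in> sites L. H w \<and> w i \<le> n} \<union> B"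
      by (auto simp: B_def A_def)
    ultimately show ?thesis
      by (simp only:) (rule sum.union_disjoint[symmetric], auto simp: B_def A_def)
  qed
  \<comment> \<open>The CZ precedes the CNOT: the phase requires the new site to hold its original
    bit.\<close>
  show ?case
  proof (rule realizable_mono[OF realizable_cong[OF realizable_comp[OF realizable_comp[OF Suc.IH cz] cnot]]],
      goal_cases)
    case (1 z)
    show ?case by (rule ext) (rule f)
  next
    case (2 z)
    show ?case by (simp only: add_0_right \<phi>)
  next
    case 4
    show ?case unfolding card by simp
  qed simp
qed

lemma realizable_prefix_phase:
  assumes "i \<in> {1,2,3::nat}"
  shows "realizable L (2 * L) (2 * L ^ 3) (prefix L i) (line_phase L i H)"
proof -
  have le: "w i \<le> L" if "w \<in> sites L" for w
    using sites_less[OF that assms] by simp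
  have "card {w \<in> sites L. w i \<noteq> 0 \<and> w i \<le> L} \<le> card (sites L)"
    by (intro card_mono) auto
  then have "realizable L (2 * L) (2 * L ^ 3)
    (\<lambda>z w. if w \<in> sites L \<and> w i \<le> L then \<Sum>a\<le>w i. z (w(i := a)) else z w)
    (\<lambda>z. \<Sum>w\<in>{w \<in> sites L. H w \<and> w i \<le> L}. z w * (\<Sum>a<w i. z (w(i := a))))"
    using realizable_mono[OF realizable_chain[OF assms, of L L H]] by (simp add: card_sites)
  then show ?thesis
    by (rule realizable_cong) (auto simp: prefix_def line_phase_def fun_eq_iff le intro!: sum.cong)
qed

lemma realizable_prefix:
  assumes "i \<in> {1,2,3::nat}"
  shows "realizable L (2 * L) (2 * L ^ 3) (prefix L i) (\<lambda>_. 0)"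
  using realizable_prefix_phase[OF assms, of L "\<lambda>_. False"]
  by (rule realizable_cong) (simp_all add: line_phase_def)

text \<open>One chain emits the phase; a second one without phase, run backwards, removes the prefix
  sums.\<close>

lemma realizable_line_phase:
  assumes "i \<in> {1,2,3::nat}"
  shows "realizable L (4 * L) (4 * L ^ 3) (\<lambda>z. z) (line_phase L i H)"
  using realizable_uncompute[OF realizable_prefix_phase[OF assms, of L H] realizable_prefix[OF assms]]
  by simp

text \<open>The two neighbours of the corner \<open>w\<close> are diagonal to each other. Factoring
  the form lets a CNOT along \<open>i\<close> and a CZ along \<open>j\<close> produce this diagonal
  coupling with nearest-neighbour gates.\<close>

definition plaquette_phase :: "nat \<Rightarrow> nat \<Rightarrow> nat \<Rightarrow> (site \<Rightarrow> bool) \<Rightarrow> bvec \<Rightarrow> bit" where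
  "plaquette_phase L i j H z = (\<Sum>w\<in>{w \<in> sites L. Suc (w i) < L \<and> Suc (w j) < L \<and> H w}.
     (z w + z (w(i := Suc (w i)))) * z (w(j := Suc (w j))))"

lemma plaquette_phase_split:
  "plaquette_phase L i j H z
    = plaquette_phase L i j (\<lambda>w. H w \<and> P w) z + plaquette_phase L i j (\<lambda>w. H w \<and> \<not> P w) z"
proof -
  have "{w \<in> sites L. Suc (w i) < L \<and> Suc (w j) < L \<and> H w}
    = {w \<in> sites L. Suc (w i) < L \<and> Suc (w j) < L \<and> H w \<and> P w}
      \<union> {w \<in> sites L. Suc (w i) < L \<and> Suc (w j) < L \<and> H w \<and> \<not> P w}"
    by auto
  then show ?thesis
    unfolding plaquette_phase_def
    by (simp only:) (rule sum.union_disjoint, auto)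
qed

lemma inj_on_shift: "inj_on (\<lambda>w::site. w(i := Suc (w i))) A"
proof (rule inj_onI)
  fix v w :: site
  assume *: "v(i := Suc (v i)) = w(i := Suc (w i))"
  show "v = w"
  proof
    fix k show "v k = w k" using fun_cong[OF *, of k] by (cases "k = i") auto
  qed
qed

text \<open>CNOT layer into the corners, CZ layer, CNOT layer again. By sparsity no neighbour along
  \<open>i\<close> or \<open>j\<close> is itself a corner, so gates of a layer are disjoint and the
  \<open>j\<close>-neighbours still hold their own bits.\<close>

lemma realizable_plaquette_sparse:
  assumes ij: "i \<in> {1,2,3::nat}" "j \<in> {1,2,3::nat}" "i \<noteq> j"
    and H: "\<And>w. H w \<Longrightarrow> \<not> H (w(i := Suc (w i)))" "\<And>w. H w \<Longrightarrow> \<not> H (w(j := Suc (w j)))"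
  shows "realizable L 3 (3 * L ^ 3) (\<lambda>z. z) (plaquette_phase L i j H)"
proof -
  define A where "A = {w \<in> sites L. Suc (w i) < L \<and> Suc (w j) < L \<and> H w}"
  define s where "s = (\<lambda>k (w::site). w(k := Suc (w k)))"
  have s: "s k v \<in> sites L \<and> adjacent (s k v) v" "s k v \<notin> A" if "v \<in> A" "k = i \<or> k = j" for k v
  proof -
    have k: "k \<in> {1,2,3}" using that(2) ij by auto
    then have "adjacent (s k v) v"
      using adjacent_upd_Suc[OF k, of "v k" "Suc (v k)" v] by (simp add: s_def)
    then show "s k v \<in> sites L \<and> adjacent (s k v) v" "s k v \<notin> A"
      using that H[of v] k by (auto simp: A_def s_def intro!: sites_upd)
  qed
  have inj: "inj_on (s k) A" for k
    unfolding s_def by (rule inj_on_shift)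
  have AS: "A \<subseteq> sites L" by (auto simp: A_def)
  have cA: "card A \<le> L ^ 3"
    using card_mono[OF finite_sites AS] by (simp add: card_sites)
  have cz: "realizable L 1 (L ^ 3) (\<lambda>z. z) (\<lambda>z. \<Sum>v\<in>A. z (s j v) * z v)"
    using s AS by (intro realizable_mono[OF realizable_CZ_layer[of A L "s j"] _ cA] inj) auto
  have cnot: "realizable L 1 (L ^ 3) (\<lambda>z w. if w \<in> A then z w + z (s i w) else z w) (\<lambda>_. 0)"
    using s AS by (intro realizable_mono[OF realizable_CNOT_layer[of A L "s i"] _ cA] inj) auto
  have "realizable L (2 * 1 + 1) (2 * L ^ 3 + L ^ 3) (\<lambda>z. z)
      (\<lambda>z. \<Sum>v\<in>A. (if s j v \<in> A then z (s j v) + z (s i (s j v)) else z (s j v)) *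
         (if v \<in> A then z v + z (s i v) else z v))"
    by (rule realizable_conj[OF cnot cz])
  then have "realizable L (2 * 1 + 1) (2 * L ^ 3 + L ^ 3) (\<lambda>z. z) (plaquette_phase L i j H)"
  proof (rule realizable_cong)
    fix z
    have "plaquette_phase L i j H z = (\<Sum>v\<in>A. (z v + z (s i v)) * z (s j v))"
      by (simp add: plaquette_phase_def A_def s_def)
    then show "(\<Sum>v\<in>A. (if s j v \<in> A then z (s j v) + z (s i (s j v)) else z (s j v)) *
         (if v \<in> A then z v + z (s i v) else z v)) = plaquette_phase L i j H z"
      by (simp add: s(2) mult.commute)
  qed simp
  then show ?thesis by simp
qed

text \<open>The parities of \<open>w i\<close> and \<open>w j\<close> split the corners into four
  sparse classes of three layers each. The constant depth 12 is weakened to \<open>12 * L\<close>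
  for uniform bookkeeping.\<close>

lemma realizable_plaquette_phase:
  assumes ij: "i \<in> {1,2,3::nat}" "j \<in> {1,2,3::nat}" "i \<noteq> j" and L: "L > 0"
  shows "realizable L (12 * L) (12 * L ^ 3) (\<lambda>z. z) (plaquette_phase L i j H)"
proof -
  have split: "realizable L (2 * d) (2 * n) (\<lambda>z. z) (plaquette_phase L i j H)"
    if "realizable L d n (\<lambda>z. z) (plaquette_phase L i j (\<lambda>w. H w \<and> P w))"
      "realizable L d n (\<lambda>z. z) (plaquette_phase L i j (\<lambda>w. H w \<and> \<not> P w))" for H d n P
    using realizable_comp[OF that] by (simp add: mult_2 flip: plaquette_phase_split)
  have "realizable L (2 * (2 * 3)) (2 * (2 * (3 * L ^ 3))) (\<lambda>z. z) (plaquette_phase L i j H)"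
    using ij
    by (intro split[where P = "\<lambda>w. even (w i)"] split[where P = "\<lambda>w. even (w j)"]
        realizable_plaquette_sparse) auto
  then show ?thesis
    by (rule realizable_mono) (use L in auto)
qed

section \<open>The quadratic form of a plane\<close>

text \<open>The disagreements between a planar snake running along the first coordinate and one
  running along the second, each pair listed once: opposite quadrants always disagree, and sites of
  one row or column disagree when that line has odd index.\<close>

definition corner :: "nat \<Rightarrow> nat \<Rightarrow> nat \<Rightarrow> nat \<Rightarrow> bit" where
  "corner a b a' b' = of_bool (a' < a \<and> b < b') + of_bool (odd b \<and> a' < a \<and> b' = b)
     + of_bool (odd a \<and> a' = a \<and> b' < b)"

lemma sum_less_of_bool:
  fixes f :: "nat \<Rightarrow> bit"
  assumes "a \<le> L"
  shows "(\<Sum>x<L. of_bool (x < a) * f x) = (\<Sum>x<a. f x)"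
  using assms by (intro sum.mono_neutral_cong_right) auto

lemma sum_greater_of_bool:
  fixes f :: "nat \<Rightarrow> bit"
  shows "(\<Sum>x<L. of_bool (b < x) * f x) = (\<Sum>x\<in>{b<..<L}. f x)"
  by (intro sum.mono_neutral_cong_right) auto

lemma sum_eq_of_bool:
  fixes f :: "nat \<Rightarrow> bit"
  assumes "b < L"
  shows "(\<Sum>x<L. of_bool (x = b) * f x) = f b"
proof -
  have "(\<Sum>x<L. of_bool (x = b) * f x) = (\<Sum>x<L. if x = b then f b else 0)"
    by (intro sum.cong) auto
  with assms show ?thesis by simp
qed

lemma sum_corner:
  fixes X :: "nat \<Rightarrow> nat \<Rightarrow> bit"
  assumes "a < L" "b < L"
  shows "(\<Sum>a'<L. \<Sum>b'<L. corner a b a' b' * X a' b')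
    = (\<Sum>a'<a. \<Sum>b'\<in>{b<..<L}. X a' b') + of_bool (odd b) * (\<Sum>a'<a. X a' b)
      + of_bool (odd a) * (\<Sum>b'<b. X a b')"
proof -
  have "(\<Sum>a'<L. \<Sum>b'<L. corner a b a' b' * X a' b')
    = (\<Sum>a'<L. \<Sum>b'<L. of_bool (a' < a) * (of_bool (b < b') * X a' b')
      + of_bool (odd b) * (of_bool (a' < a) * (of_bool (b' = b) * X a' b'))
      + of_bool (odd a) * (of_bool (a' = a) * (of_bool (b' < b) * X a' b')))"
    by (intro sum.cong refl) (simp add: corner_def of_bool_conj distrib_right mult.assoc)
  also have "\<dots> = (\<Sum>a'<a. \<Sum>b'\<in>{b<..<L}. X a' b') + of_bool (odd b) * (\<Sum>a'<a. X a' b)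
      + of_bool (odd a) * (\<Sum>b'<b. X a b')"
    by (simp only: sum.distrib sum_distrib_left[symmetric] sum_greater_of_bool
        sum_less_of_bool[OF less_imp_le[OF assms(1)]] sum_less_of_bool[OF less_imp_le[OF assms(2)]]
        sum_eq_of_bool[OF assms(1)] sum_eq_of_bool[OF assms(2)])
  finally show ?thesis .
qed

text \<open>Summation by parts: both sides run over pairs of indices, grouped by the smaller index
  on the left and by the larger one on the right.\<close>

lemma sum_above_by_parts:
  fixes f g :: "nat \<Rightarrow> bit"
  shows "(\<Sum>b<Suc n. f b * (\<Sum>b'\<in>{b<..<Suc n}. g b')) = (\<Sum>b<n. (\<Sum>b'\<le>b. f b') * g (Suc b))"
proof (induction n)
  case (Suc n)
  have "{Suc n<..<Suc (Suc n)} = {}"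
    by auto
  then have "(\<Sum>b<Suc (Suc n). f b * (\<Sum>b'\<in>{b<..<Suc (Suc n)}. g b'))
      = (\<Sum>b<Suc n. f b * (\<Sum>b'\<in>{b<..<Suc (Suc n)}. g b'))"
    by (subst sum.lessThan_Suc) simp
  also have "\<dots> = (\<Sum>b<Suc n. f b * g (Suc n) + f b * (\<Sum>b'\<in>{b<..<Suc n}. g b'))"
  proof (intro sum.cong refl)
    fix b assume "b \<in> {..<Suc n}"
    then have "{b<..<Suc (Suc n)} = insert (Suc n) {b<..<Suc n}"
      by auto
    then show "f b * (\<Sum>b'\<in>{b<..<Suc (Suc n)}. g b')
        = f b * g (Suc n) + f b * (\<Sum>b'\<in>{b<..<Suc n}. g b')"
      by (simp add: distrib_left)
  qed
  also have "\<dots> = (\<Sum>b\<le>n. f b) * g (Suc n) + (\<Sum>b<n. (\<Sum>b'\<le>b. f b') * g (Suc b))"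
    by (simp only: sum.distrib Suc.IH flip: sum_distrib_right lessThan_Suc_atMost)
  finally show ?case
    by (simp only: sum.lessThan_Suc[of _ n] add.commute)
next
  case 0
  have "{0<..<Suc 0} = {}"
    by auto
  then show ?case
    by simp
qed

text \<open>With \<open>R\<close> the two-dimensional prefix sums of \<open>X\<close>, the interaction of a site with its
  whole opposite quadrant becomes an interaction within single plaquettes.\<close>
lemma corner_eq_plaquettes:
  fixes X :: "nat \<Rightarrow> nat \<Rightarrow> bit"
  defines "U \<equiv> \<lambda>a b. \<Sum>b'\<le>b. X a b'"
  defines "R \<equiv> \<lambda>a b. \<Sum>a'\<le>a. U a' b"
  shows "(\<Sum>a<L. \<Sum>b<L. of_bool (b \<noteq> L - 1) * (U a b * (\<Sum>a'<a. U a' b)))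
      + (\<Sum>a<L. \<Sum>b<L. of_bool (Suc a < L \<and> Suc b < L) * ((R a b + R (Suc a) b) * R a (Suc b)))
    = (\<Sum>a<L. \<Sum>b<L. X a b * (\<Sum>a'<a. \<Sum>b'\<in>{b<..<L}. X a' b'))"
proof (cases L)
  case (Suc n)
  have last: "(\<Sum>b<Suc n. of_bool (b \<noteq> n) * f b) = (\<Sum>b<n. f b)" for f :: "nat \<Rightarrow> bit"
    by (rule sum.mono_neutral_cong_right) auto
  have last': "(\<Sum>b<Suc n. of_bool (b < n) * f b) = (\<Sum>b<n. f b)" for f :: "nat \<Rightarrow> bit"
    by (rule sum_less_of_bool) simp
  have "(\<Sum>a<L. \<Sum>b<L. of_bool (b \<noteq> L - 1) * (U a b * (\<Sum>a'<a. U a' b)))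
      = (\<Sum>a<Suc n. \<Sum>b<n. U a b * (\<Sum>a'<a. U a' b))"
    by (simp only: Suc diff_Suc_1 last)
  \<comment> \<open>The row \<open>a = 0\<close> has an empty inner sum; after the shift the inner
    sum is \<open>R a b\<close>.\<close>
  also have "\<dots> = (\<Sum>a<n. \<Sum>b<n. U (Suc a) b * R a b)"
    by (subst sum.lessThan_Suc_shift) (simp add: R_def lessThan_Suc_atMost)
  finally have 1: "(\<Sum>a<L. \<Sum>b<L. of_bool (b \<noteq> L - 1) * (U a b * (\<Sum>a'<a. U a' b)))
      = (\<Sum>a<n. \<Sum>b<n. U (Suc a) b * R a b)" .
  have "(\<Sum>a<L. \<Sum>b<L. of_bool (Suc a < L \<and> Suc b < L) * ((R a b + R (Suc a) b) * R a (Suc b)))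
      = (\<Sum>a<Suc n. of_bool (a < n) * (\<Sum>b<Suc n. of_bool (b < n) * ((R a b + R (Suc a) b) * R a (Suc b))))"
    by (simp only: Suc Suc_less_eq of_bool_conj mult.assoc sum_distrib_left)
  also have "\<dots> = (\<Sum>a<n. \<Sum>b<n. (R a b + R (Suc a) b) * R a (Suc b))"
    by (simp only: last')
  \<comment> \<open>In characteristic two the sum of consecutive prefix sums is their difference
    \<open>U (Suc a) b\<close>.\<close>
  also have "\<dots> = (\<Sum>a<n. \<Sum>b<n. U (Suc a) b * R a (Suc b))"
    by (simp add: R_def)
  finally have 2: "(\<Sum>a<L. \<Sum>b<L. of_bool (Suc a < L \<and> Suc b < L) * ((R a b + R (Suc a) b) * R a (Suc b)))
      = (\<Sum>a<n. \<Sum>b<n. U (Suc a) b * R a (Suc b))" .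
  have R: "R a b + R a (Suc b) = (\<Sum>a'\<le>a. X a' (Suc b))" for a b
    by (simp add: R_def U_def flip: sum.distrib)
  have "(\<Sum>a<L. \<Sum>b<L. X a b * (\<Sum>a'<a. \<Sum>b'\<in>{b<..<L}. X a' b'))
      = (\<Sum>a<n. \<Sum>b<Suc n. X (Suc a) b * (\<Sum>a'\<le>a. \<Sum>b'\<in>{b<..<Suc n}. X a' b'))"
    unfolding Suc by (subst sum.lessThan_Suc_shift) (simp add: lessThan_Suc_atMost del: sum.lessThan_Suc)
  \<comment> \<open>Summation by parts in \<open>b\<close>. Of the two resulting products, the line
    term supplies the one with \<open>R a b\<close>, the plaquettes the one with
    \<open>R a (Suc b)\<close>.\<close>
  also have "\<dots> = (\<Sum>a<n. \<Sum>b<n. U (Suc a) b * (R a b + R a (Suc b)))"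
    by (subst sum.swap[of _ "{_<..<Suc n}"], subst sum_above_by_parts) (simp add: R U_def)
  finally show ?thesis
    unfolding 1 2 by (simp add: distrib_left sum.distrib)
qed simp

definition plane_form :: "nat \<Rightarrow> (nat \<Rightarrow> nat \<Rightarrow> bit) \<Rightarrow> bit" where
  "plane_form L X = (\<Sum>a<L. \<Sum>b<L. X a b * (\<Sum>a'<L. \<Sum>b'<L. corner a b a' b' * X a' b'))"

section \<open>Coordinates along chosen axes\<close>

definition axes :: "nat \<Rightarrow> nat \<Rightarrow> nat \<Rightarrow> bool" where
  "axes i j k \<longleftrightarrow> {i, j, k} = {1, 2, 3}"

lemma axes_distinct:
  assumes "axes i j k"
  shows "i \<noteq> j" "i \<noteq> k" "j \<noteq> k"
proof -
  have "card {i, j, k} = 3" using assms by (simp add: axes_def)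
  then show "i \<noteq> j" "i \<noteq> k" "j \<noteq> k" by (auto simp: card_insert_if split: if_splits)
qed

lemma axes_in:
  assumes "axes i j k"
  shows "i \<in> {1,2,3}" "j \<in> {1,2,3}" "k \<in> {1,2,3}"
  using assms unfolding axes_def by blast+

text \<open>The default \<open>undefined\<close> matches extensionality of lattice sites, so every
  site is a \<open>point\<close>.\<close>

definition point :: "nat \<Rightarrow> nat \<Rightarrow> nat \<Rightarrow> nat \<Rightarrow> nat \<Rightarrow> nat \<Rightarrow> site" where
  "point i j k a b c = (\<lambda>_. undefined)(i := a, j := b, k := c)"

context
  fixes i j k :: nat
  assumes axes: "axes i j k"
begin

lemma point_simps [simp]:
  "point i j k a b c i = a" "point i j k a b c j = b" "point i j k a b c k = c"
  "(point i j k a b c)(i := a') = point i j k a' b c"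
  "(point i j k a b c)(j := b') = point i j k a b' c"
  "(point i j k a b c)(k := c') = point i j k a b c'"
  using axes_distinct[OF axes] by (simp_all add: point_def fun_upd_twist)

lemma point_sites: "point i j k a b c \<in> sites L \<longleftrightarrow> a < L \<and> b < L \<and> c < L"
proof
  assume p: "point i j k a b c \<in> sites L"
  show "a < L \<and> b < L \<and> c < L"
    using axes_in[OF axes, THEN sites_less[OF p]] by simp
next
  have S: "{1, 2, 3} = {i, j, k}"
    using axes unfolding axes_def by (rule sym)
  assume abc: "a < L \<and> b < L \<and> c < L"
  show "point i j k a b c \<in> sites L"
    unfolding sites_def S
  proof (rule PiE_I)
    show "point i j k a b c x \<in> {..<L}" if "x \<in> {i, j, k}" for x
      using that abc by auto
    show "point i j k a b c x = undefined" if "x \<notin> {i, j, k}" for x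
      using that by (simp add: point_def)
  qed
qed

lemma point_coords: "v \<in> sites L \<Longrightarrow> point i j k (v i) (v j) (v k) = v"
proof (rule PiE_ext[of _ "{1,2,3}" "\<lambda>_. {..<L}"])
  assume v: "v \<in> sites L"
  then show "v \<in> {1,2,3} \<rightarrow>\<^sub>E {..<L}" by (simp add: sites_def)
  show "point i j k (v i) (v j) (v k) \<in> {1,2,3} \<rightarrow>\<^sub>E {..<L}"
    unfolding sites_def[symmetric] point_sites using axes_in[OF axes, THEN sites_less[OF v]] by simp
  fix x :: nat
  assume "x \<in> {1,2,3}"
  then have "x = i \<or> x = j \<or> x = k"
    using axes unfolding axes_def by blast
  then show "point i j k (v i) (v j) (v k) x = v x" by auto
qed

lemma sum_sites:
  fixes f :: "site \<Rightarrow> bit"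
  shows "(\<Sum>v\<in>sites L. f v) = (\<Sum>c<L. \<Sum>a<L. \<Sum>b<L. f (point i j k a b c))"
proof -
  have "(\<Sum>v\<in>sites L. f v)
      = (\<Sum>(c, a, b)\<in>{..<L} \<times> {..<L} \<times> {..<L}. f (point i j k a b c))"
    by (rule sum.reindex_bij_witness[where i = "\<lambda>(c, a, b). point i j k a b c"
          and j = "\<lambda>v. (v k, v i, v j)"])
      (auto simp: point_sites point_coords dest: sites_less[OF _ axes_in(1)[OF axes]]
        sites_less[OF _ axes_in(2)[OF axes]] sites_less[OF _ axes_in(3)[OF axes]])
  then show ?thesis
    by (simp add: sum.cartesian_product)
qed

lemma sum_sites_filter:
  fixes f :: "site \<Rightarrow> bit"
  shows "(\<Sum>v\<in>{v \<in> sites L. P v}. f v)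
    = (\<Sum>c<L. \<Sum>a<L. \<Sum>b<L. of_bool (P (point i j k a b c)) * f (point i j k a b c))"
proof -
  have "(\<Sum>v\<in>{v \<in> sites L. P v}. f v) = (\<Sum>v\<in>sites L. of_bool (P v) * f v)"
    by (rule sum.mono_neutral_cong_left) auto
  then show ?thesis by (simp only: sum_sites)
qed

text \<open>\<open>H\<close> selects the planes that are acted on, all of them in parallel. The
  budget is \<open>2 + 2 + 12\<close> for the chains and plaquettes, \<open>2 + 2\<close> for
  undoing the chains and \<open>4 + 4\<close> for the line phases.\<close>

lemma realizable_plane_form:
  assumes L: "L > 0"
  shows "realizable L (28 * L) (28 * L ^ 3) (\<lambda>z. z)
    (\<lambda>z. \<Sum>c<L. of_bool (H c) * plane_form L (\<lambda>a b. z (point i j k a b c)))"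
proof -
  note ij = axes_in(1,2)[OF axes] axes_distinct(1)[OF axes]
  \<comment> \<open>The chain along \<open>j\<close> turns bits into \<open>U\<close>; the chain
    along \<open>i\<close> turns these into \<open>R\<close> while emitting the line phase of the
    plaquette identity.\<close>
  have 1: "realizable L (20 * L) (20 * L ^ 3) (\<lambda>z. z)
    (\<lambda>z. line_phase L i (\<lambda>w. w j \<noteq> L - 1 \<and> H (w k)) (prefix L j z)
      + plaquette_phase L i j (\<lambda>w. H (w k)) (prefix L i (prefix L j z)))"
    using realizable_uncompute[OF
        realizable_comp[OF
          realizable_comp[OF realizable_prefix[OF ij(2)]
            realizable_prefix_phase[OF ij(1), where H = "\<lambda>w. w j \<noteq> L - 1 \<and> H (w k)"]]
          realizable_plaquette_phase[OF ij L, where H = "\<lambda>w. H (w k)"]]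
        realizable_comp[OF realizable_prefix[OF ij(2)] realizable_prefix[OF ij(1)]]]
    by simp
  \<comment> \<open>The added phases are the odd-row and odd-column terms of \<open>corner\<close>,
    on the original bits.\<close>
  have 2: "realizable L (28 * L) (28 * L ^ 3) (\<lambda>z. z)
    (\<lambda>z. line_phase L i (\<lambda>w. w j \<noteq> L - 1 \<and> H (w k)) (prefix L j z)
      + plaquette_phase L i j (\<lambda>w. H (w k)) (prefix L i (prefix L j z))
      + line_phase L i (\<lambda>w. odd (w j) \<and> H (w k)) z
      + line_phase L j (\<lambda>w. odd (w i) \<and> H (w k)) z)"
    using realizable_comp[OF realizable_comp[OF 1
        realizable_line_phase[OF ij(1), where H = "\<lambda>w. odd (w j) \<and> H (w k)"]]
        realizable_line_phase[OF ij(2), where H = "\<lambda>w. odd (w i) \<and> H (w k)"]]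
    by simp
  show ?thesis
  proof (rule realizable_cong[OF 2])
    fix z :: bvec
    define X where "X = (\<lambda>c a b. z (point i j k a b c))"
    define U where "U = (\<lambda>c a b. \<Sum>b'\<le>b. X c a b')"
    define R where "R = (\<lambda>c a b. \<Sum>a'\<le>a. U c a' b)"
    have pj: "prefix L j z (point i j k a b c) = U c a b" if "a < L" "b < L" "c < L" for a b c
      using that by (simp add: prefix_def point_sites U_def X_def)
    have pi: "prefix L i (prefix L j z) (point i j k a b c) = R c a b" if "a < L" "b < L" "c < L" for a b c
      using that unfolding R_def prefix_def[of L i] by (simp add: point_sites pj)
    have "line_phase L i (\<lambda>w. w j \<noteq> L - 1 \<and> H (w k)) (prefix L j z)
        = (\<Sum>c<L. \<Sum>a<L. \<Sum>b<L. of_bool (b \<noteq> L - 1 \<and> H c) * (U c a b * (\<Sum>a'<a. U c a' b)))"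
      unfolding line_phase_def sum_sites_filter by (intro sum.cong refl) (simp add: pj)
    also have "\<dots> = (\<Sum>c<L. of_bool (H c) * (\<Sum>a<L. \<Sum>b<L. of_bool (b \<noteq> L - 1) * (U c a b * (\<Sum>a'<a. U c a' b))))"
      by (simp only: sum_distrib_left of_bool_conj mult_ac)
    finally have A: "line_phase L i (\<lambda>w. w j \<noteq> L - 1 \<and> H (w k)) (prefix L j z)
        = (\<Sum>c<L. of_bool (H c) * (\<Sum>a<L. \<Sum>b<L. of_bool (b \<noteq> L - 1) * (U c a b * (\<Sum>a'<a. U c a' b))))" .
    have "plaquette_phase L i j (\<lambda>w. H (w k)) (prefix L i (prefix L j z))
        = (\<Sum>c<L. \<Sum>a<L. \<Sum>b<L. of_bool (Suc a < L \<and> Suc b < L \<and> H c)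
            * ((R c a b + R c (Suc a) b) * R c a (Suc b)))"
      unfolding plaquette_phase_def sum_sites_filter
    proof (intro sum.cong refl)
      fix c a b assume "c \<in> {..<L}" "a \<in> {..<L}" "b \<in> {..<L}"
      then show "of_bool (Suc (point i j k a b c i) < L \<and> Suc (point i j k a b c j) < L \<and> H (point i j k a b c k)) *
          ((prefix L i (prefix L j z) (point i j k a b c) +
            prefix L i (prefix L j z) ((point i j k a b c)(i := Suc (point i j k a b c i)))) *
           prefix L i (prefix L j z) ((point i j k a b c)(j := Suc (point i j k a b c j)))) =
          of_bool (Suc a < L \<and> Suc b < L \<and> H c) * ((R c a b + R c (Suc a) b) * R c a (Suc b))"
        \<comment> \<open>At the boundary a shifted point leaves the lattice and \<open>pi\<close>
          does not cover it, but there the indicator vanishes.\<close>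
        by (cases "Suc a < L \<and> Suc b < L") (auto simp: pi)
    qed
    also have "\<dots> = (\<Sum>c<L. of_bool (H c) * (\<Sum>a<L. \<Sum>b<L. of_bool (Suc a < L \<and> Suc b < L)
            * ((R c a b + R c (Suc a) b) * R c a (Suc b))))"
      by (simp only: sum_distrib_left of_bool_conj mult_ac)
    finally have B: "plaquette_phase L i j (\<lambda>w. H (w k)) (prefix L i (prefix L j z))
        = (\<Sum>c<L. of_bool (H c) * (\<Sum>a<L. \<Sum>b<L. of_bool (Suc a < L \<and> Suc b < L)
            * ((R c a b + R c (Suc a) b) * R c a (Suc b))))" .
    have C: "line_phase L i (\<lambda>w. odd (w j) \<and> H (w k)) z
        = (\<Sum>c<L. of_bool (H c) * (\<Sum>a<L. \<Sum>b<L. X c a b * (of_bool (odd b) * (\<Sum>a'<a. X c a' b))))"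
      unfolding line_phase_def sum_sites_filter X_def
      by (simp only: point_simps sum_distrib_left of_bool_conj mult_ac)
    have D: "line_phase L j (\<lambda>w. odd (w i) \<and> H (w k)) z
        = (\<Sum>c<L. of_bool (H c) * (\<Sum>a<L. \<Sum>b<L. X c a b * (of_bool (odd a) * (\<Sum>b'<b. X c a b'))))"
      unfolding line_phase_def sum_sites_filter X_def
      by (simp only: point_simps sum_distrib_left of_bool_conj mult_ac)
    have "plane_form L (X c)
        = (\<Sum>a<L. \<Sum>b<L. of_bool (b \<noteq> L - 1) * (U c a b * (\<Sum>a'<a. U c a' b)))
        + (\<Sum>a<L. \<Sum>b<L. of_bool (Suc a < L \<and> Suc b < L) * ((R c a b + R c (Suc a) b) * R c a (Suc b)))
        + (\<Sum>a<L. \<Sum>b<L. X c a b * (of_bool (odd b) * (\<Sum>a'<a. X c a' b)))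
        + (\<Sum>a<L. \<Sum>b<L. X c a b * (of_bool (odd a) * (\<Sum>b'<b. X c a b')))" for c
      unfolding plane_form_def R_def U_def corner_eq_plaquettes
      by (simp add: sum_corner distrib_left sum.distrib)
    moreover have "(\<lambda>a b. z (point i j k a b c)) = X c" for c
      by (simp add: X_def)
    ultimately show "line_phase L i (\<lambda>w. w j \<noteq> L - 1 \<and> H (w k)) (prefix L j z)
      + plaquette_phase L i j (\<lambda>w. H (w k)) (prefix L i (prefix L j z))
      + line_phase L i (\<lambda>w. odd (w j) \<and> H (w k)) z
      + line_phase L j (\<lambda>w. odd (w i) \<and> H (w k)) z
      = (\<Sum>c<L. of_bool (H c) * plane_form L (\<lambda>a b. z (point i j k a b c)))"
      unfolding A B C D by (simp only: distrib_left sum.distrib)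
  qed simp
qed

end

section \<open>Snake orderings\<close>

definition convertible :: "nat \<Rightarrow> nat \<Rightarrow> (site \<Rightarrow> nat) \<Rightarrow> (site \<Rightarrow> nat) \<Rightarrow> bool" where
  "convertible L c m m' \<longleftrightarrow> (\<exists>E. inversion_form L m m' E \<and>
     realizable L (c * L) (c * L ^ 3) (\<lambda>z. z) (quad_form L E))"

lemma convertible_refl: "convertible L 0 m m"
proof -
  have "inversion_form L m m (\<lambda>_ _. 0)"
    by (simp add: inversion_form_def)
  moreover have "realizable L (0 * L) (0 * L ^ 3) (\<lambda>z. z) (quad_form L (\<lambda>_ _. 0))"
    using realizable_cong[OF realizable_id] by (simp add: quad_form_def)
  ultimately show ?thesis
    unfolding convertible_def by blast
qed

text \<open>Disagreements add modulo two: the comparisons by the intermediate ordering occur twice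
  and cancel.\<close>

lemma convertible_trans:
  assumes "convertible L c m m'" "convertible L d m' m''"
  shows "convertible L (c + d) m m''"
proof -
  obtain E where E: "inversion_form L m m' E" "realizable L (c * L) (c * L ^ 3) (\<lambda>z. z) (quad_form L E)"
    using assms(1) unfolding convertible_def by blast
  obtain F where F: "inversion_form L m' m'' F" "realizable L (d * L) (d * L ^ 3) (\<lambda>z. z) (quad_form L F)"
    using assms(2) unfolding convertible_def by blast
  have "inversion_form L m m'' (\<lambda>v w. E v w + F v w)"
    unfolding inversion_form_def
  proof (intro conjI ballI)
    fix v w assume vw: "v \<in> sites L" "w \<in> sites L"
    have "(E v w + F v w) + (E w v + F w v) = (E v w + E w v) + (F v w + F w v)"
      by (simp only: add_ac)
    also have "E v w + E w v = of_bool (m w < m v) + of_bool (m' w < m' v)"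
      using E(1) vw unfolding inversion_form_def by blast
    also have "F v w + F w v = of_bool (m' w < m' v) + of_bool (m'' w < m'' v)"
      using F(1) vw unfolding inversion_form_def by blast
    also have "of_bool (m w < m v) + of_bool (m' w < m' v) + (of_bool (m' w < m' v) + of_bool (m'' w < m'' v))
        = of_bool (m w < m v) + (of_bool (m'' w < m'' v) :: bit)"
      by (simp only: add.assoc bit_add_self_left)
    finally show "(E v w + F v w) + (E w v + F w v) = of_bool (m w < m v) + of_bool (m'' w < m'' v)" .
  qed (use E(1) F(1) in \<open>simp add: inversion_form_def\<close>)
  moreover have "realizable L ((c + d) * L) ((c + d) * L ^ 3) (\<lambda>z. z) (quad_form L (\<lambda>v w. E v w + F v w))"
    by (rule realizable_cong[OF realizable_comp[OF E(2) F(2), folded add_mult_distrib]])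
      (simp_all only: quad_form_add)
  ultimately show ?thesis
    unfolding convertible_def by blast
qed

lemma convertible_circuit:
  assumes "convertible L c m m'"
  shows "\<exists>C. circuit_ok L C \<and> gate_count C \<le> c * L ^ 3 \<and> depth C \<le> c * L \<and>
    maps_encoding L m m' (circuit_op L C)"
proof -
  obtain E where inv: "inversion_form L m m' E"
    and "realizable L (c * L) (c * L ^ 3) (\<lambda>z. z) (quad_form L E)"
    using assms unfolding convertible_def by blast
  then obtain C where C: "circuit_ok L C" "\<forall>g\<in>set (concat C). two_qubit g"
    "depth C \<le> c * L" "gate_count C \<le> c * L ^ 3"
    and run: "\<And>z. run_map (concat C) z = z" "\<And>z. run_phase (concat C) z = quad_form L E z"
    unfolding realizable_def by blast
  have ok: "gate_ok L g \<and> two_qubit g" if "g \<in> set (concat C)" for g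
    using C(1,2) that by (auto simp: circuit_ok_def layer_ok_def)
  \<comment> \<open>The trivial state map makes the circuit operator diagonal.\<close>
  have act: "fold gate_act (concat C) y = y" for y
    unfolding bvec_of_inj[symmetric] bvec_of_fold_gate_act run ..
  have "maps_encoding L m m' (circuit_op L C)"
    using inv
  proof (rule maps_encoding_if_diagonal)
    fix x y assume "x \<in> basis L" "y \<in> basis L"
    with ok show "circuit_op L C x y = (if x = y then sign (quad_form L E (bvec_of y)) else 0)"
      unfolding circuit_op_def by (subst fold_gate_op) (simp_all only: act run)
  qed
  with C show ?thesis
    by blast
qed

text \<open>Horner form in base \<open>L\<close>; the top digit is unreflected because its sum of
  higher coordinates is empty.\<close>

definition snake3 :: "nat \<Rightarrow> nat \<Rightarrow> nat \<Rightarrow> nat \<Rightarrow> site \<Rightarrow> nat" where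
  "snake3 L p q r v = rho L (v q + v r) (v p) + L * (rho L (v r) (v q) + L * v r)"

lemma snake_eq_snake3: "snake L \<sigma> = snake3 L (\<sigma> 1) (\<sigma> 2) (\<sigma> 3)"
proof
  fix v
  have "{1..3::nat} = {1, 2, 3}" "{2..3::nat} = {2, 3}" "{3..3::nat} = {3}" "{4..3::nat} = {}"
    by auto
  then show "snake L \<sigma> v = snake3 L (\<sigma> 1) (\<sigma> 2) (\<sigma> 3) v"
    by (simp add: snake_def snake3_def rho_def algebra_simps power2_eq_square numeral_eq_Suc)
qed

lemma digit_less_iff:
  fixes a a' b b' n :: nat
  assumes "a < n" "a' < n"
  shows "a + n * b < a' + n * b' \<longleftrightarrow> b < b' \<or> b = b' \<and> a < a'"
proof (cases b b' rule: linorder_cases)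
  case less
  then have "n * Suc b \<le> n * b'" by (intro mult_le_mono2) simp
  with assms less show ?thesis by simp
next
  case greater
  then have "n * Suc b' \<le> n * b" by (intro mult_le_mono2) simp
  with assms greater show ?thesis by simp
qed simp

lemma digit_eq_iff:
  fixes a a' b b' n :: nat
  assumes "a < n" "a' < n"
  shows "a + n * b = a' + n * b' \<longleftrightarrow> b = b' \<and> a = a'"
  using digit_less_iff[OF assms, of b b'] digit_less_iff[OF assms(2,1), of b' b] by force

lemma rho_less: "t < L \<Longrightarrow> rho L s t < L"
  by (auto simp: rho_def)

lemma rho_eq_iff: "t < L \<Longrightarrow> t' < L \<Longrightarrow> rho L s t = rho L s t' \<longleftrightarrow> t = t'"
  by (auto simp: rho_def)

lemma rho_less_iff:
  "t < L \<Longrightarrow> t' < L \<Longrightarrow> rho L s t < rho L s t' \<longleftrightarrow> (if even s then t < t' else t' < t)"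
  by (auto simp: rho_def)

text \<open>Base-\<open>L\<close> numbers compare lexicographically. Once the higher digits agree,
  both sites use the same reflection, which reverses the comparison when its parameter is
  odd.\<close>

lemma snake3_less_iff:
  assumes "v p < L" "v q < L" "w p < L" "w q < L"
  shows "snake3 L p q r w < snake3 L p q r v \<longleftrightarrow> w r < v r \<or> w r = v r \<and>
    ((if even (v r) then w q < v q else v q < w q) \<or> w q = v q \<and>
      (if even (v q + v r) then w p < v p else v p < w p))"
  unfolding snake3_def using assms
  by (cases "w r = v r"; cases "w q = v q")
    (simp_all add: digit_less_iff digit_eq_iff rho_less rho_less_iff rho_eq_iff del: even_add)

text \<open>Distinct planes of constant \<open>r\<close> keep their relative order. For odd
  \<open>r\<close> both planar orders are reversed as a whole, so the set of disagreements is the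
  same in every plane.\<close>

lemma inversion_form_swap_low:
  assumes "axes p q r"
  shows "inversion_form L (snake3 L p q r) (snake3 L q p r)
    (\<lambda>v w. of_bool (w r = v r) * corner (v p) (v q) (w p) (w q))"
  unfolding inversion_form_def
proof (intro conjI ballI)
  fix v w assume "v \<in> sites L" "w \<in> sites L"
  then have lt: "v p < L" "v q < L" "w p < L" "w q < L"
    using axes_in[OF assms] by (blast dest: sites_less)+
  show "of_bool (w r = v r) * corner (v p) (v q) (w p) (w q) + of_bool (v r = w r) * corner (w p) (w q) (v p) (v q)
    = of_bool (snake3 L p q r w < snake3 L p q r v) + of_bool (snake3 L q p r w < snake3 L q p r v)"
    unfolding snake3_less_iff[where L = L and v = v and w = w, OF lt]
      snake3_less_iff[where L = L and v = v and w = w, OF lt(2,1,4,3)] corner_def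
    by (cases "v r" "w r" rule: linorder_cases; cases "v p" "w p" rule: linorder_cases;
        cases "v q" "w q" rule: linorder_cases; cases "even (v r)"; simp)
qed (simp add: corner_def)

text \<open>The direction along \<open>p\<close> depends on \<open>v q + v r\<close>, which is
  symmetric, so sites of a common line never disagree; other pairs are compared by the planar snakes
  in \<open>q\<close> and \<open>r\<close>.\<close>

lemma inversion_form_swap_high:
  assumes "axes p q r"
  shows "inversion_form L (snake3 L p q r) (snake3 L p r q)
    (\<lambda>v w. corner (v q) (v r) (w q) (w r))"
  unfolding inversion_form_def
proof (intro conjI ballI)
  fix v w assume "v \<in> sites L" "w \<in> sites L"
  then have lt: "v p < L" "v q < L" "v r < L" "w p < L" "w q < L" "w r < L"
    using axes_in[OF assms] by (blast dest: sites_less)+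
  show "corner (v q) (v r) (w q) (w r) + corner (w q) (w r) (v q) (v r)
    = of_bool (snake3 L p q r w < snake3 L p q r v) + of_bool (snake3 L p r q w < snake3 L p r q v)"
    unfolding snake3_less_iff[where L = L and v = v and w = w, OF lt(1,2,4,5)]
      snake3_less_iff[where L = L and v = v and w = w, OF lt(1,3,4,6)] corner_def
    by (cases "v q" "w q" rule: linorder_cases; cases "v r" "w r" rule: linorder_cases; simp add: add.commute)
qed (simp add: corner_def)

lemma convertible_swap_low:
  assumes ax: "axes p q r" and L: "L > 0"
  shows "convertible L 32 (snake3 L p q r) (snake3 L q p r)"
proof -
  let ?E = "\<lambda>v w. of_bool (w r = v r) * corner (v p) (v q) (w p) (w q)"
  have "realizable L (32 * L) (32 * L ^ 3) (\<lambda>z. z) (quad_form L ?E)"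
  \<comment> \<open>The cost 28 is rounded up to 32, the cost of the other swap.\<close>
  proof (rule realizable_mono[OF realizable_cong[OF realizable_plane_form[OF ax L, of "\<lambda>_. True"]]])
    fix z :: bvec
    let ?z = "\<lambda>a b c. z (point p q r a b c)"
    have "quad_form L ?E z = (\<Sum>c<L. \<Sum>a<L. \<Sum>b<L. \<Sum>c'<L. of_bool (c' = c) *
        (?z a b c * (\<Sum>a'<L. \<Sum>b'<L. corner a b a' b' * ?z a' b' c')))"
      unfolding quad_form_def sum_sites[OF ax]
      by (simp only: point_simps[OF ax] sum_distrib_left mult_ac)
    also have "\<dots> = (\<Sum>c<L. of_bool True * plane_form L (\<lambda>a b. ?z a b c))"
      unfolding plane_form_def by (intro sum.cong refl) (simp add: sum_eq_of_bool)
    finally show "(\<Sum>c<L. of_bool True * plane_form L (\<lambda>a b. ?z a b c)) = quad_form L ?E z" ..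
  qed simp_all
  with inversion_form_swap_low[OF ax] show ?thesis
    unfolding convertible_def by blast
qed

text \<open>Both orderings traverse whole lines along \<open>p\<close>, each line in the same direction, so only the
  parities of these lines interact; \<open>prefix\<close> collects them in the plane \<open>v p = L - 1\<close>.\<close>
lemma convertible_swap_high:
  assumes ax: "axes p q r" and L: "L > 0"
  shows "convertible L 32 (snake3 L p q r) (snake3 L p r q)"
proof -
  let ?E = "\<lambda>v w. corner (v q) (v r) (w q) (w r)"
  have ax': "axes q r p"
    using ax unfolding axes_def by blast
  have "realizable L (2 * (2 * L) + 28 * L) (2 * (2 * L ^ 3) + 28 * L ^ 3) (\<lambda>z. z) (quad_form L ?E)"
  proof (rule realizable_cong[OF realizable_conj[OF realizable_prefix[OF axes_in(1)[OF ax]]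
          realizable_plane_form[OF ax' L, of "\<lambda>c. c = L - 1"]]])
    fix z :: bvec
    let ?z = "\<lambda>a b c. z (point q r p a b c)"
    \<comment> \<open>In the last plane the prefix sum covers the whole line, that is, its
      parity.\<close>
    have pre: "prefix L p z (point q r p a b (L - 1)) = (\<Sum>c<L. ?z a b c)" if "a < L" "b < L" for a b
      using that L lessThan_Suc_atMost[of "L - 1"]
      by (simp add: prefix_def point_sites[OF ax'] point_simps[OF ax'])
    have "quad_form L ?E z = (\<Sum>c<L. \<Sum>a<L. \<Sum>b<L. \<Sum>c'<L. ?z a b c *
        (\<Sum>a'<L. \<Sum>b'<L. corner a b a' b' * ?z a' b' c'))"
      unfolding quad_form_def sum_sites[OF ax']
      by (simp only: point_simps[OF ax'] sum_distrib_left mult_ac)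
    \<comment> \<open>The kernel does not involve \<open>c\<close> or \<open>c'\<close>, so summing
      over them replaces both bits by line parities.\<close>
    also have "\<dots> = (\<Sum>c<L. \<Sum>a<L. \<Sum>b<L. ?z a b c *
        (\<Sum>a'<L. \<Sum>b'<L. corner a b a' b' * (\<Sum>c'<L. ?z a' b' c')))"
    proof (intro sum.cong refl)
      fix c a b
      have "(\<Sum>c'<L. \<Sum>a'<L. \<Sum>b'<L. corner a b a' b' * ?z a' b' c')
          = (\<Sum>a'<L. \<Sum>b'<L. corner a b a' b' * (\<Sum>c'<L. ?z a' b' c'))"
        unfolding sum_distrib_left
        by (rule trans[OF sum.swap sum.cong[OF refl sum.swap]])
      then show "(\<Sum>c'<L. ?z a b c * (\<Sum>a'<L. \<Sum>b'<L. corner a b a' b' * ?z a' b' c'))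
          = ?z a b c * (\<Sum>a'<L. \<Sum>b'<L. corner a b a' b' * (\<Sum>c'<L. ?z a' b' c'))"
        by (simp only: sum_distrib_left[symmetric])
    qed
    also have "\<dots> = (\<Sum>a<L. \<Sum>b<L. \<Sum>c<L. ?z a b c *
        (\<Sum>a'<L. \<Sum>b'<L. corner a b a' b' * (\<Sum>c'<L. ?z a' b' c')))"
      by (rule trans[OF sum.swap sum.cong[OF refl sum.swap]])
    also have "\<dots> = plane_form L (\<lambda>a b. \<Sum>c<L. ?z a b c)"
      unfolding plane_form_def by (simp only: sum_distrib_right)
    also have "\<dots> = plane_form L (\<lambda>a b. prefix L p z (point q r p a b (L - 1)))"
      unfolding plane_form_def by (intro sum.cong arg_cong2[where f = "(*)"] refl) (simp_all only: pre lessThan_iff)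
    also have "\<dots> = (\<Sum>c<L. of_bool (c = L - 1) * plane_form L (\<lambda>a b. prefix L p z (point q r p a b c)))"
      using L by (subst sum_eq_of_bool) simp_all
    finally show "(\<Sum>c<L. of_bool (c = L - 1) * plane_form L (\<lambda>a b. prefix L p z (point q r p a b c)))
        = quad_form L ?E z" ..
  qed simp
  with inversion_form_swap_high[OF ax] show ?thesis
    unfolding convertible_def by auto
qed

lemma convertible_mono:
  "convertible L c m m' \<Longrightarrow> c \<le> d \<Longrightarrow> convertible L d m m'"
  unfolding convertible_def by (meson realizable_mono mult_le_mono1)

lemma axes_permutes:
  assumes "\<sigma> permutes {1,2,3::nat}"
  shows "axes (\<sigma> 1) (\<sigma> 2) (\<sigma> 3)"
  using permutes_image[OF assms] by (simp add: axes_def)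

lemma axes_rearrange:
  assumes "axes p q r" "axes p' q' r'"
  shows "(p', q', r') \<in> {(p, q, r), (q, p, r), (p, r, q), (q, r, p), (r, p, q), (r, q, p)}"
proof -
  have "p' \<in> {p, q, r}" "q' \<in> {p, q, r}" "r' \<in> {p, q, r}"
    using assms unfolding axes_def by blast+
  then show ?thesis
    using axes_distinct[OF assms(2)] by auto
qed

text \<open>The two adjacent transpositions generate all six hierarchies; the reversal takes three
  of them, whence \<open>96 = 3 * 32\<close>.\<close>

lemma convertible_snake3:
  assumes ax: "axes p q r" "axes p' q' r'" and L: "L > 0"
  shows "convertible L 96 (snake3 L p q r) (snake3 L p' q' r')"
proof -
  have low: "convertible L 32 (snake3 L i j k) (snake3 L j i k)"
    and high: "convertible L 32 (snake3 L i j k) (snake3 L i k j)" if "{i, j, k} = {p, q, r}" for i j k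
    using that ax(1) L convertible_swap_low convertible_swap_high by (simp_all add: axes_def)
  note tr = convertible_trans
  have "convertible L 32 (snake3 L p q r) (snake3 L q p r)"
    "convertible L 32 (snake3 L p q r) (snake3 L p r q)"
    "convertible L (32 + 32) (snake3 L p q r) (snake3 L q r p)"
    "convertible L (32 + 32) (snake3 L p q r) (snake3 L r p q)"
    "convertible L (32 + 32 + 32) (snake3 L p q r) (snake3 L r q p)"
    by (rule low high tr[OF low high] tr[OF high low] tr[OF tr[OF low high] low]; blast)+
  with axes_rearrange[OF ax] convertible_refl[of L "snake3 L p q r"] show ?thesis
    by (auto intro: convertible_mono)
qed

theorem mainTheorem12:
  shows "\<exists>K::real. \<forall>L::nat. \<forall>\<sigma> \<sigma>'. \<sigma> permutes {1,2,3::nat} \<longrightarrow> \<sigma>' permutes {1,2,3::nat} \<longrightarrow>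
    (\<exists>C. circuit_ok L C \<and> real (gate_count C) \<le> K * real L ^ 3 \<and> real (depth C) \<le> K * real L \<and>
         maps_encoding L (snake L \<sigma>) (snake L \<sigma>') (circuit_op L C))"
proof (intro exI[of _ "96::real"] allI impI)
  fix L :: nat and \<sigma> \<sigma>' :: "nat \<Rightarrow> nat"
  assume perm: "\<sigma> permutes {1,2,3::nat}" "\<sigma>' permutes {1,2,3::nat}"
  show "\<exists>C. circuit_ok L C \<and> real (gate_count C) \<le> 96 * real L ^ 3 \<and> real (depth C) \<le> 96 * real L \<and>
         maps_encoding L (snake L \<sigma>) (snake L \<sigma>') (circuit_op L C)"
  \<comment> \<open>Without sites the empty circuit works; the bounds for the swaps assume
    \<open>L > 0\<close>.\<close>
  proof (cases "L = 0")
    case True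
    then have "sites L = {}"
      by (auto simp: sites_def)
    then show ?thesis
      by (intro exI[of _ "[]"]) (simp add: circuit_ok_def gate_count_def depth_def maps_encoding_def)
  next
    case False
    then have "convertible L 96 (snake L \<sigma>) (snake L \<sigma>')"
      unfolding snake_eq_snake3 using perm by (intro convertible_snake3 axes_permutes) simp_all
    then obtain C where "circuit_ok L C" "gate_count C \<le> 96 * L ^ 3" "depth C \<le> 96 * L"
      "maps_encoding L (snake L \<sigma>) (snake L \<sigma>') (circuit_op L C)"
      using convertible_circuit by blast
    moreover from this have "real (gate_count C) \<le> real (96 * L ^ 3)" "real (depth C) \<le> real (96 * L)"
      by (simp_all only: of_nat_le_iff)
    ultimately show ?thesis
      by auto
  qed
qed

end
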